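(* Let $(X^n,Y^n)=(X_i,Y_i)_{i=1}^n$ be a sequence of pairs of random variables and $U$ a random variable such that, given $U$, the pairs $(X_i,Y_i)$, $1\le i\le n$, are conditionally independent. Then $$\rho_{\mathrm m}(X^n;Y^n|U)=\max_{1\le i\le n}\rho_{\mathrm m}(X_i;Y_i|U).$$
   Context: All random variables are defined on a common probability space and are real-valued; $X^n=(X_1,\dots,X_n)$ and $Y^n=(Y_1,\dots,Y_n)$ are random vectors. Conditional Pearson correlation of real-valued $A,B$ given $U$: $\rho(A;B|U)=\frac{\mathbb{E}[\mathrm{cov}(A,B|U)]}{\sqrt{\mathbb{E}[\mathrm{var}(A|U)]}\sqrt{\mathbb{E}[\mathrm{var}(B|U)]}}$ if $\mathbb{E}[\mathrm{var}(A|U)]\,\mathbb{E}[\mathrm{var}(B|U)]>0$, and $0$ if this product is $0$. Conditional maximal correlation of random variables (or vectors) $X,Y$ given $U$: $\rho_{\mathrm m}(X;Y|U)=\sup_{f,g}\rho(f(X,U);g(Y,U)|U)$, the supremum over Borel-measurable real-valued $f(x,u),g(y,u)$ with $\mathbb{E}[\mathrm{var}(f(X,U)|U)]<\infty$ and $\mathbb{E}[\mathrm{var}(g(Y,U)|U)]<\infty$. *)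

theory Defs
  imports "HOL-Probability.Probability"
begin

definition sigma_of :: "'a measure \<Rightarrow> ('a \<Rightarrow> real) \<Rightarrow> 'a measure"
  where "sigma_of M U = vimage_algebra (space M) U borel"

(* The indicators' conditional expectations are the conditional probabilities
   P(Z_i \<in> A_i for all i \<in> J | F) and P(Z_i \<in> A_i | F). *)
definition cond_indep_vars ::
    "'a measure \<Rightarrow> 'a measure \<Rightarrow> ('i \<Rightarrow> 'b measure) \<Rightarrow> ('i \<Rightarrow> 'a \<Rightarrow> 'b) \<Rightarrow> 'i set \<Rightarrow> bool"
  where "cond_indep_vars M F N Z I \<longleftrightarrow>
    (\<forall>i\<in>I. Z i \<in> measurable M (N i)) \<and>
    (\<forall>J A. J \<subseteq> I \<longrightarrow> finite J \<longrightarrow> (\<forall>i\<in>J. A i \<in> sets (N i)) \<longrightarrow>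
      (AE \<omega> in M.
        real_cond_exp M F (indicator {\<omega> \<in> space M. \<forall>i\<in>J. Z i \<omega> \<in> A i}) \<omega> =
        (\<Prod>i\<in>J. real_cond_exp M F (indicator {\<omega> \<in> space M. Z i \<omega> \<in> A i}) \<omega>)))"

(* The conditional variance takes values in [0, \<infinity>], so that finiteness of its expectation
   is a genuine condition. A itself need not be integrable: real_cond_exp is built from the
   conditional expectations of the positive and negative parts, and wherever one of these is
   infinite the conditional variance below is infinite (a.e.) too. *)
definition cond_var :: "'a measure \<Rightarrow> 'a measure \<Rightarrow> ('a \<Rightarrow> real) \<Rightarrow> 'a \<Rightarrow> ennreal"
  where "cond_var M F A =
    nn_cond_exp M F (\<lambda>\<omega>. ennreal ((A \<omega> - real_cond_exp M F A \<omega>)\<^sup>2))"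

definition cond_cov ::
    "'a measure \<Rightarrow> 'a measure \<Rightarrow> ('a \<Rightarrow> real) \<Rightarrow> ('a \<Rightarrow> real) \<Rightarrow> 'a \<Rightarrow> real"
  where "cond_cov M F A B =
    real_cond_exp M F
      (\<lambda>\<omega>. (A \<omega> - real_cond_exp M F A \<omega>) * (B \<omega> - real_cond_exp M F B \<omega>))"

definition expected_cond_var :: "'a measure \<Rightarrow> 'a measure \<Rightarrow> ('a \<Rightarrow> real) \<Rightarrow> ennreal"
  where "expected_cond_var M F A = (\<integral>\<^sup>+ \<omega>. cond_var M F A \<omega> \<partial>M)"

(* Only meaningful when both expected conditional variances are finite. *)
definition cond_corr ::
    "'a measure \<Rightarrow> 'a measure \<Rightarrow> ('a \<Rightarrow> real) \<Rightarrow> ('a \<Rightarrow> real) \<Rightarrow> real"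
  where "cond_corr M F A B =
    (if expected_cond_var M F A * expected_cond_var M F B > 0
     then (\<integral>\<omega>. cond_cov M F A B \<omega> \<partial>M) /
       (sqrt (enn2real (expected_cond_var M F A)) * sqrt (enn2real (expected_cond_var M F B)))
     else 0)"

(* X and Y take values in the measurable spaces S and T, so that the definition covers
   real random variables (borel) as well as random vectors
   (PiM {1..n} (\<lambda>_. borel), the Borel sets of n-space).
   The supremum is over a nonempty set of reals bounded by 1 (Cauchy-Schwarz). *)
definition cond_max_corr ::
    "'a measure \<Rightarrow> 'b measure \<Rightarrow> ('a \<Rightarrow> 'b) \<Rightarrow> 'c measure \<Rightarrow> ('a \<Rightarrow> 'c) \<Rightarrow> ('a \<Rightarrow> real) \<Rightarrow> real"
  where "cond_max_corr M S X T Y U =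
    Sup {cond_corr M (sigma_of M U) (\<lambda>\<omega>. f (X \<omega>, U \<omega>)) (\<lambda>\<omega>. g (Y \<omega>, U \<omega>)) | f g.
      f \<in> borel_measurable (S \<Otimes>\<^sub>M borel) \<and>
      g \<in> borel_measurable (T \<Otimes>\<^sub>M borel) \<and>
      expected_cond_var M (sigma_of M U) (\<lambda>\<omega>. f (X \<omega>, U \<omega>)) < \<infinity> \<and>
      expected_cond_var M (sigma_of M U) (\<lambda>\<omega>. g (Y \<omega>, U \<omega>)) < \<infinity>}"

end

theory Submission
  imports Defs
begin

text \<open>Write \<open>F\<close> for the sigma-algebra of \<open>U\<close>. Subtracting conditional expectations turns
  \<open>\<rho>(X;Y|U) \<le> r\<close> into \<open>E[a b] \<le> r \<parallel>a\<parallel> \<parallel>b\<parallel>\<close> for all square integrable \<open>a\<close>, \<open>b\<close> with zero conditional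
  expectation given \<open>F\<close>, measurable with respect to \<open>(X,U)\<close> and \<open>(Y,U)\<close>. By induction
  it suffices to join two conditionally independent blocks, and by density to treat finite sums
  \<open>g = \<Sum> a\<^sub>k 1\<^bsub>C k\<^esub>\<close> with \<open>a\<^sub>k\<close> from the first block and \<open>C k\<close> from the second one. Splitting \<open>a\<^sub>k\<close> into
  \<open>a\<^sub>k - E[a\<^sub>k|F]\<close> and \<open>E[a\<^sub>k|F]\<close> splits \<open>g\<close> orthogonally into \<open>g\<^sub>1 + g\<^sub>2\<close>, where \<open>g\<^sub>2\<close> lives on the second
  block and the mixed terms vanish by conditional independence. For \<open>g\<^sub>1\<close>, refine the \<open>C k\<close> to
  a partition; on a cell \<open>C\<close>, conditional independence gives
  \<open>E[a b 1\<^bsub>C\<^esub>] = E[a b P(C|F)]\<close>, so the bound of the first block applies to \<open>a\<close> and \<open>b\<close> weighted by the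
  \<open>F\<close>-measurable function \<open>sqrt (P(C|F))\<close>. No disintegration is needed.\<close>

section \<open>Square-integrable functions\<close>

text \<open>Every block plays two roles. Conditional independence holds between the algebras
  \<open>G1\<close> and \<open>G2\<close> generated by the pairs \<open>(X i, Y i)\<close> and
  \<open>U\<close>; the correlation bound compares an X-part \<open>A\<close> with a Y-part
  \<open>B\<close> of one block, and these may depend on each other in any way. All these algebras
  contain \<open>F\<close>, so centering never leaves them. The constant does not deteriorate under
  a join because the splitting is orthogonal on both sides: if the parts of the two functions have
  norms s, t and s', t', then r s s' + r t t' is at most r times the product of the full norms, by
  Cauchy-Schwarz in the plane. One obstacle comes from the definition of the correlation: a finite
  expected conditional variance does not make \<open>f (X, U)\<close> integrable, so the linear
  rules for conditional expectations become available only after centering.\<close>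

definition sq_int :: "'a measure \<Rightarrow> ('a \<Rightarrow> real) \<Rightarrow> bool"
  where "sq_int M f \<longleftrightarrow> f \<in> borel_measurable M \<and> integrable M (\<lambda>x. (f x)\<^sup>2)"

definition l2norm :: "'a measure \<Rightarrow> ('a \<Rightarrow> real) \<Rightarrow> real"
  where "l2norm M f = sqrt (\<integral>x. (f x)\<^sup>2 \<partial>M)"

lemma sq_int_measurable [measurable_dest]: "sq_int M f \<Longrightarrow> f \<in> borel_measurable M"
  by (simp add: sq_int_def)

lemma sq_int_integrable_power2: "sq_int M f \<Longrightarrow> integrable M (\<lambda>x. (f x)\<^sup>2)"
  by (simp add: sq_int_def)

lemma sq_int_integrable_mult:
  assumes "sq_int M f" "sq_int M g"
  shows "integrable M (\<lambda>x. f x * g x)"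
proof (rule Bochner_Integration.integrable_bound)
  show "integrable M (\<lambda>x. (f x)\<^sup>2 + (g x)\<^sup>2)"
    using assms by (auto simp: sq_int_def)
  show "(\<lambda>x. f x * g x) \<in> borel_measurable M"
    using assms by (auto simp: sq_int_def)
  have "\<bar>u * v\<bar> \<le> u\<^sup>2 + v\<^sup>2" for u v :: real
  proof -
    have "2 * (\<bar>u\<bar> * \<bar>v\<bar>) \<le> u\<^sup>2 + v\<^sup>2"
      using sum_squares_bound[of "\<bar>u\<bar>" "\<bar>v\<bar>"] by simp
    moreover have "0 \<le> \<bar>u\<bar> * \<bar>v\<bar>" by simp
    ultimately show ?thesis unfolding abs_mult by linarith
  qed
  then show "AE x in M. norm (f x * g x) \<le> norm ((f x)\<^sup>2 + (g x)\<^sup>2)"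
    by auto
qed

lemma sq_int_bound:
  assumes "sq_int M g" "f \<in> borel_measurable M" "AE x in M. \<bar>f x\<bar> \<le> \<bar>g x\<bar>"
  shows "sq_int M f"
  unfolding sq_int_def
proof (intro conjI assms(2) Bochner_Integration.integrable_bound[OF sq_int_integrable_power2[OF assms(1)]])
  show "(\<lambda>x. (f x)\<^sup>2) \<in> borel_measurable M" using assms(2) by measurable
  show "AE x in M. norm ((f x)\<^sup>2) \<le> norm ((g x)\<^sup>2)"
    using assms(3) by (auto simp: abs_le_square_iff)
qed

lemma sq_int_zero [simp]: "sq_int M (\<lambda>x. 0)"
  by (simp add: sq_int_def)

lemma sq_int_cmult: "sq_int M f \<Longrightarrow> sq_int M (\<lambda>x. c * f x)"
  by (auto simp: sq_int_def power_mult_distrib)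

lemma sq_int_add:
  assumes "sq_int M f" "sq_int M g"
  shows "sq_int M (\<lambda>x. f x + g x)"
  using assms sq_int_integrable_mult[OF assms]
  by (auto simp: sq_int_def power2_sum mult.assoc)

lemma sq_int_diff:
  assumes "sq_int M f" "sq_int M g"
  shows "sq_int M (\<lambda>x. f x - g x)"
  using sq_int_add[OF assms(1) sq_int_cmult[OF assms(2), of "-1"]] by simp

lemma sq_int_sum:
  assumes "\<And>i. i \<in> I \<Longrightarrow> sq_int M (f i)"
  shows "sq_int M (\<lambda>x. \<Sum>i\<in>I. f i x)"
  using assms by (induction I rule: infinite_finite_induct) (auto intro: sq_int_add)

lemma sq_int_mult_indicator:
  assumes "sq_int M f" "C \<in> sets M"
  shows "sq_int M (\<lambda>x. f x * indicator C x)"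
  by (rule sq_int_bound[OF assms(1)]) (use assms in \<open>auto simp: sq_int_def indicator_def\<close>)

lemma l2norm_nonneg [simp]: "0 \<le> l2norm M f"
  by (simp add: l2norm_def)

lemma l2norm_power2: "(l2norm M f)\<^sup>2 = (\<integral>x. (f x)\<^sup>2 \<partial>M)"
  by (simp add: l2norm_def)

lemma l2norm_cong_AE:
  assumes "AE x in M. f x = g x" "f \<in> borel_measurable M" "g \<in> borel_measurable M"
  shows "l2norm M f = l2norm M g"
  unfolding l2norm_def using assms by (intro arg_cong[where f = sqrt] integral_cong_AE) auto

lemma l2norm_eq_0_imp_AE:
  assumes "sq_int M f" "l2norm M f = 0"
  shows "AE x in M. f x = 0"
  using assms integral_nonneg_eq_0_iff_AE[OF sq_int_integrable_power2[OF assms(1)]]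
  by (simp add: l2norm_def)

lemma l2norm_power2_add:
  assumes "sq_int M f" "sq_int M g"
  shows "(l2norm M (\<lambda>x. f x + g x))\<^sup>2
    = (l2norm M f)\<^sup>2 + (l2norm M g)\<^sup>2 + 2 * (\<integral>x. f x * g x \<partial>M)"
proof -
  have "(\<integral>x. (f x + g x)\<^sup>2 \<partial>M) = (\<integral>x. (f x)\<^sup>2 + (g x)\<^sup>2 + 2 * (f x * g x) \<partial>M)"
    by (intro Bochner_Integration.integral_cong) (auto simp: power2_sum)
  also have "\<dots> = (\<integral>x. (f x)\<^sup>2 \<partial>M) + (\<integral>x. (g x)\<^sup>2 \<partial>M) + 2 * (\<integral>x. f x * g x \<partial>M)"
    using assms sq_int_integrable_mult[OF assms] by (simp add: sq_int_def)
  finally show ?thesis by (simp add: l2norm_power2)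
qed

lemma integral_Cauchy_Schwarz:
  assumes f: "sq_int M f" and g: "sq_int M g"
  shows "\<bar>\<integral>x. f x * g x \<partial>M\<bar> \<le> l2norm M f * l2norm M g"
proof (cases "l2norm M g = 0")
  case True
  from l2norm_eq_0_imp_AE[OF g this] have "AE x in M. f x * g x = 0" by auto
  then have "(\<integral>x. f x * g x \<partial>M) = 0" by (rule integral_eq_zero_AE)
  then show ?thesis by (simp add: True)
next
  case False
  \<comment> \<open>This \<open>t\<close> minimizes the norm of \<open>f - t * g\<close>: it is the
    coefficient of the projection of \<open>f\<close> onto \<open>g\<close>.\<close>
  define t where "t = (\<integral>x. f x * g x \<partial>M) / (l2norm M g)\<^sup>2"
  have "0 \<le> (\<integral>x. (f x - t * g x)\<^sup>2 \<partial>M)" by simp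
  also have "\<dots> = (\<integral>x. (f x)\<^sup>2 + t\<^sup>2 * (g x)\<^sup>2 - 2 * t * (f x * g x) \<partial>M)"
    by (intro Bochner_Integration.integral_cong) (auto simp: power2_diff power_mult_distrib)
  also have "\<dots> = (l2norm M f)\<^sup>2 + t\<^sup>2 * (l2norm M g)\<^sup>2 - 2 * t * (\<integral>x. f x * g x \<partial>M)"
    using f g sq_int_integrable_mult[OF f g] by (simp add: sq_int_def l2norm_power2)
  finally have "(\<integral>x. f x * g x \<partial>M)\<^sup>2 \<le> (l2norm M f * l2norm M g)\<^sup>2"
  proof -
    assume *: "0 \<le> (l2norm M f)\<^sup>2 + t\<^sup>2 * (l2norm M g)\<^sup>2 - 2 * t * (\<integral>x. f x * g x \<partial>M)"
    define q where "q = (l2norm M g)\<^sup>2"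
    have q: "q > 0" using False by (simp add: q_def)
    have "0 \<le> (l2norm M f)\<^sup>2 - (\<integral>x. f x * g x \<partial>M)\<^sup>2 / q"
      using * q unfolding t_def q_def[symmetric] by (simp add: power2_eq_square)
    then show ?thesis
      using q by (simp add: power_mult_distrib q_def[symmetric] field_simps)
  qed
  then show ?thesis
    by (metis abs_le_square_iff abs_of_nonneg l2norm_nonneg mult_nonneg_nonneg)
qed

section \<open>Conditional expectation as an orthogonal projection\<close>

lemma (in prob_space) sigma_finite_subalgebra_if_subalgebra:
  assumes "subalgebra M F"
  shows "sigma_finite_subalgebra M F"
  using assms finite_measure_axioms
  by (intro finite_measure_subalgebra_is_sigma_finite)
     (simp add: finite_measure_subalgebra_def finite_measure_subalgebra_axioms_def)

context prob_space
begin

lemma sq_int_imp_integrable: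
  assumes "sq_int M f" shows "integrable M f"
proof -
  have "sq_int M (\<lambda>x. 1)" by (simp add: sq_int_def)
  from sq_int_integrable_mult[OF assms this] show ?thesis by simp
qed

lemma sq_int_indicator:
  assumes "C \<in> sets M" shows "sq_int M (indicator C :: 'a \<Rightarrow> real)"
  using assms emeasure_finite[of C]
  by (auto simp: sq_int_def indicator_def power2_eq_square less_top[symmetric]
        intro!: integrable_const_bound[where B = 1])

text \<open>Conditional Jensen inequality for the convex function x^2.\<close>

lemma real_cond_exp_sq_int:
  assumes F: "subalgebra M F" and f: "sq_int M f"
  shows "sq_int M (real_cond_exp M F f)"
proof -
  interpret F: sigma_finite_subalgebra M F
    by (rule sigma_finite_subalgebra_if_subalgebra[OF F])
  have "convex_on UNIV (\<lambda>x::real. x\<^sup>2)" by (rule convex_power2)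
  then have "integrable M (\<lambda>x. (real_cond_exp M F f x)\<^sup>2)"
    using F.integrable_convex_cond_exp[OF sq_int_imp_integrable[OF f], where I = UNIV and q = "\<lambda>x. x\<^sup>2"] f
    by (auto simp: sq_int_def)
  then show ?thesis by (simp add: sq_int_def)
qed

lemma real_cond_exp_integral_mult:
  assumes F: "subalgebra M F" and f: "sq_int M f" and h: "sq_int M h" "h \<in> borel_measurable F"
  shows "(\<integral>x. h x * real_cond_exp M F f x \<partial>M) = (\<integral>x. h x * f x \<partial>M)"
proof -
  interpret F: sigma_finite_subalgebra M F
    by (rule sigma_finite_subalgebra_if_subalgebra[OF F])
  show ?thesis
    using sq_int_integrable_mult[OF h(1) f] h(2) f by (intro F.real_cond_exp_intg) auto
qed

lemma integral_mult_eq_0_if_real_cond_exp_eq_0: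
  assumes F: "subalgebra M F" and f: "sq_int M f" "AE x in M. real_cond_exp M F f x = 0"
    and h: "sq_int M h" "h \<in> borel_measurable F"
  shows "(\<integral>x. f x * h x \<partial>M) = 0"
proof -
  have "(\<integral>x. h x * real_cond_exp M F f x \<partial>M) = 0"
    using f(2) by (intro integral_eq_zero_AE) auto
  then show ?thesis
    using real_cond_exp_integral_mult[OF F f(1) h] by (simp add: mult.commute)
qed

lemma real_cond_exp_centered:
  assumes F: "subalgebra M F" and f: "integrable M f"
  shows "AE x in M. real_cond_exp M F (\<lambda>x. f x - real_cond_exp M F f x) x = 0"
proof -
  interpret F: sigma_finite_subalgebra M F
    by (rule sigma_finite_subalgebra_if_subalgebra[OF F])
  have i: "integrable M (real_cond_exp M F f)" using f by (rule F.real_cond_exp_int)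
  have "AE x in M. real_cond_exp M F (real_cond_exp M F f) x = real_cond_exp M F f x"
    using i by (rule F.real_cond_exp_F_meas) simp
  with F.real_cond_exp_diff[OF f i] show ?thesis by eventually_elim simp
qed

text \<open>Pythagoras: \<open>f\<close> is the orthogonal sum of its centered part and its
  conditional expectation.\<close>

lemma l2norm_centered_le:
  assumes F: "subalgebra M F" and f: "sq_int M f"
  shows "l2norm M (\<lambda>x. f x - real_cond_exp M F f x) \<le> l2norm M f"
proof -
  let ?m = "real_cond_exp M F f" and ?c = "\<lambda>x. f x - real_cond_exp M F f x"
  have m: "sq_int M ?m" by (rule real_cond_exp_sq_int[OF F f])
  have c: "sq_int M ?c" by (rule sq_int_diff[OF f m])
  have "(\<integral>x. ?c x * ?m x \<partial>M) = 0"
    by (rule integral_mult_eq_0_if_real_cond_exp_eq_0[OF F c real_cond_exp_centered m])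
       (use F f in \<open>auto intro: sq_int_imp_integrable\<close>)
  from l2norm_power2_add[OF c m] this
  have "(l2norm M ?c)\<^sup>2 \<le> (l2norm M f)\<^sup>2" by simp
  then show ?thesis by (rule power2_le_imp_le) simp
qed

end

section \<open>Maximal correlation as a correlation bound on sub-sigma-algebras\<close>

text \<open>The product form avoids the quotient: vanishing norms need no separate case, and the
  inequality passes to limits in mean square. It is one-sided because correlations enter the
  supremum with their sign.\<close>

definition mc_bound ::
    "'a measure \<Rightarrow> 'a measure \<Rightarrow> 'a measure \<Rightarrow> 'a measure \<Rightarrow> real \<Rightarrow> bool"
  where "mc_bound M F A B r \<longleftrightarrow>
    (\<forall>a b. sq_int M a \<longrightarrow> a \<in> borel_measurable A \<longrightarrow> (AE x in M. real_cond_exp M F a x = 0) \<longrightarrow>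
       sq_int M b \<longrightarrow> b \<in> borel_measurable B \<longrightarrow> (AE x in M. real_cond_exp M F b x = 0) \<longrightarrow>
       (\<integral>x. a x * b x \<partial>M) \<le> r * (l2norm M a * l2norm M b))"

lemma mc_boundD:
  assumes "mc_bound M F A B r"
    and "sq_int M a" "a \<in> borel_measurable A" "AE x in M. real_cond_exp M F a x = 0"
    and "sq_int M b" "b \<in> borel_measurable B" "AE x in M. real_cond_exp M F b x = 0"
  shows "(\<integral>x. a x * b x \<partial>M) \<le> r * (l2norm M a * l2norm M b)"
  using assms unfolding mc_bound_def by blast

lemma mc_bound_1: "mc_bound M F A B 1"
  unfolding mc_bound_def
  by (auto intro: order_trans[OF abs_ge_self integral_Cauchy_Schwarz])

lemma mc_bound_mono:
  assumes "mc_bound M F A B r" "r \<le> s" shows "mc_bound M F A B s"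
  unfolding mc_bound_def
  by (intro allI impI order_trans[OF mc_boundD[OF assms(1)] mult_right_mono[OF assms(2)]])
    simp_all

text \<open>In \<open>subalgebra A A'\<close> the second argument is the smaller algebra, so bounds
  are inherited downwards.\<close>

lemma mc_bound_subalgebra:
  assumes "mc_bound M F A B r" "subalgebra A A'" "subalgebra B B'"
  shows "mc_bound M F A' B' r"
  unfolding mc_bound_def
  by (intro allI impI mc_boundD[OF assms(1)] measurable_from_subalg[OF assms(2)]
      measurable_from_subalg[OF assms(3)])

section \<open>Sigma-algebras generated by a map, and factorization through that map\<close>

lemma subalgebra_vimage_algebra:
  assumes "Z \<in> measurable M N"
  shows "subalgebra M (vimage_algebra (space M) Z N)"
proof -
  have "Z \<in> space M \<rightarrow> space N" using assms by (auto dest: measurable_space)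
  then show ?thesis
    using measurable_sets[OF assms] by (auto simp: subalgebra_def sets_vimage_algebra2)
qed

text \<open>Every level set of \<open>s\<close> is the preimage under \<open>Z\<close> of some
  measurable \<open>B y\<close>. The chosen \<open>B y\<close> may overlap off the range of
  \<open>Z\<close>, but at a point \<open>Z x\<close> exactly one of them, the one for
  \<open>y = s x\<close>, contributes to the sum.\<close>

lemma simple_function_vimage_algebra_factorization:
  fixes s :: "'a \<Rightarrow> real"
  assumes Z: "Z \<in> \<Omega> \<rightarrow> space N" and s: "simple_function (vimage_algebra \<Omega> Z N) s"
  obtains t :: "'b \<Rightarrow> real" where "t \<in> borel_measurable N" "\<And>x. x \<in> \<Omega> \<Longrightarrow> s x = t (Z x)"
proof -
  have "\<forall>y. \<exists>B. B \<in> sets N \<and> Z -` B \<inter> \<Omega> = s -` {y} \<inter> \<Omega>"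
  proof
    fix y
    have "s -` {y} \<inter> \<Omega> \<in> {Z -` B \<inter> \<Omega> | B. B \<in> sets N}"
      using simple_functionD(2)[OF s, of "{y}"] unfolding sets_vimage_algebra2[OF Z] by simp
    then show "\<exists>B. B \<in> sets N \<and> Z -` B \<inter> \<Omega> = s -` {y} \<inter> \<Omega>" by auto
  qed
  from choice[OF this] obtain B where
    B: "\<And>y. B y \<in> sets N" "\<And>y. Z -` B y \<inter> \<Omega> = s -` {y} \<inter> \<Omega>"
    by blast
  define t where "t z = (\<Sum>y\<in>s ` \<Omega>. y * indicator (B y) z)" for z
  have fin: "finite (s ` \<Omega>)" using simple_functionD(1)[OF s] by simp
  have "t \<in> borel_measurable N"
    unfolding t_def using B(1) by (intro borel_measurable_sum borel_measurable_times) auto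
  moreover have "s x = t (Z x)" if x: "x \<in> \<Omega>" for x
  proof -
    have "y * indicator (B y) (Z x) = (if y = s x then y else 0)" for y
      using B(2)[of y] x by (auto simp: indicator_def)
    then show ?thesis
      using fin x by (simp add: t_def sum.delta')
  qed
  ultimately show thesis by (rule that)
qed

text \<open>Doob-Dynkin lemma, obtained from the simple case by pointwise limits.\<close>

lemma borel_measurable_vimage_algebra_factorization:
  fixes f :: "'a \<Rightarrow> real"
  assumes Z: "Z \<in> \<Omega> \<rightarrow> space N" and f: "f \<in> borel_measurable (vimage_algebra \<Omega> Z N)"
  obtains g :: "'b \<Rightarrow> real" where "g \<in> borel_measurable N" "\<And>x. x \<in> \<Omega> \<Longrightarrow> f x = g (Z x)"
proof -
  from borel_measurable_implies_sequence_metric[OF f, of 0] obtain s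
    where s: "\<And>i. simple_function (vimage_algebra \<Omega> Z N) (s i)"
      and lim: "\<And>x. x \<in> \<Omega> \<Longrightarrow> (\<lambda>i. s i x) \<longlonglongrightarrow> f x"
    by auto
  have "\<forall>i. \<exists>t. t \<in> borel_measurable N \<and> (\<forall>x\<in>\<Omega>. s i x = t (Z x))"
    using simple_function_vimage_algebra_factorization[OF Z s] by metis
  from choice[OF this] obtain t where
    t: "\<And>i. t i \<in> borel_measurable N" "\<And>i x. x \<in> \<Omega> \<Longrightarrow> s i x = t i (Z x)"
    by blast
  show thesis
  proof
    \<comment> \<open>Convergence of \<open>t i z\<close> is known only on the range of
      \<open>Z\<close>; the total function \<open>lim\<close> is measurable everywhere and has the
      right value there.\<close>
    show "(\<lambda>z. lim (\<lambda>i. t i z)) \<in> borel_measurable N"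
      using t(1) by (rule borel_measurable_lim_metric)
    show "f x = lim (\<lambda>i. t i (Z x))" if "x \<in> \<Omega>" for x
      using lim[OF that] t(2)[OF that] by (simp add: limI)
  qed
qed

section \<open>From conditional correlation to inner products of centered functions\<close>

context prob_space
begin

lemma expected_cond_var_eq:
  assumes F: "subalgebra M F" and a: "a \<in> borel_measurable M"
  shows "expected_cond_var M F a = (\<integral>\<^sup>+x. ennreal ((a x - real_cond_exp M F a x)\<^sup>2) \<partial>M)"
proof -
  interpret F: sigma_finite_subalgebra M F
    by (rule sigma_finite_subalgebra_if_subalgebra[OF F])
  show ?thesis
    unfolding expected_cond_var_def cond_var_def
    using F.nn_cond_exp_intg[of "\<lambda>x. 1" "\<lambda>x. ennreal ((a x - real_cond_exp M F a x)\<^sup>2)"] a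
    by simp
qed

text \<open>Pulling out an \<open>F\<close>-measurable factor without integrability of
  \<open>a\<close>: the rule is applied to the nonnegative conditional expectations of the positive
  and negative parts, where infinite values are allowed.\<close>

lemma real_cond_exp_mult_indicator:
  assumes F: "subalgebra M F" and H: "H \<in> sets F" and a[measurable]: "a \<in> borel_measurable M"
  shows "AE x in M. real_cond_exp M F (\<lambda>x. indicator H x * a x) x = indicator H x * real_cond_exp M F a x"
proof -
  interpret F: sigma_finite_subalgebra M F
    by (rule sigma_finite_subalgebra_if_subalgebra[OF F])
  have *: "AE x in M. indicator H x * nn_cond_exp M F (\<lambda>x. ennreal (b x)) x
      = nn_cond_exp M F (\<lambda>x. ennreal (indicator H x * b x)) x"
    if [measurable]: "b \<in> borel_measurable M" for b :: "'a \<Rightarrow> real"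
  proof -
    have "(\<lambda>x. ennreal (indicator H x * b x)) = (\<lambda>x. indicator H x * ennreal (b x))"
      by (auto simp: indicator_def)
    then show ?thesis
      using F.nn_cond_exp_prod[of "indicator H" "\<lambda>x. ennreal (b x)"] H by simp
  qed
  have "AE x in M. indicator H x * nn_cond_exp M F (\<lambda>x. ennreal (a x)) x
      = nn_cond_exp M F (\<lambda>x. ennreal (indicator H x * a x)) x" by (rule *) simp
  moreover have "AE x in M. indicator H x * nn_cond_exp M F (\<lambda>x. ennreal (- a x)) x
      = nn_cond_exp M F (\<lambda>x. ennreal (- (indicator H x * a x))) x"
    using *[of "\<lambda>x. - a x"] by simp
  ultimately show ?thesis
    unfolding real_cond_exp_def
  proof eventually_elim
    case (elim x)
    \<comment> \<open>The factor is 0 or 1, so a case distinction replaces distributivity over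
      possibly infinite values.\<close>
    show ?case unfolding elim[symmetric] by (auto simp: indicator_def)
  qed
qed

text \<open>As \<open>a\<close> may fail to be integrable, linearity of the conditional expectation is only applied
  on the \<open>F\<close>-measurable sets where the conditional expectation of \<open>a\<close> is bounded.\<close>

lemma real_cond_exp_centered_sq_int:
  assumes F: "subalgebra M F" and a: "a \<in> borel_measurable M"
    and c: "sq_int M (\<lambda>x. a x - real_cond_exp M F a x)"
  shows "AE x in M. real_cond_exp M F (\<lambda>x. a x - real_cond_exp M F a x) x = 0"
proof -
  interpret F: sigma_finite_subalgebra M F
    by (rule sigma_finite_subalgebra_if_subalgebra[OF F])
  let ?m = "real_cond_exp M F a"
  let ?c = "\<lambda>x. a x - ?m x"
  note [measurable] = a
  have "AE x in M. \<bar>?m x\<bar> \<le> real k \<longrightarrow> real_cond_exp M F ?c x = 0" for k :: nat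
  proof -
    define H where "H = {x \<in> space F. \<bar>?m x\<bar> \<le> real k}"
    have H: "H \<in> sets F" unfolding H_def by measurable
    then have HM: "H \<in> sets M" using F by (auto simp: subalgebra_def)
    have sp: "space F = space M" using F by (simp add: subalgebra_def)
    have 1: "integrable M (\<lambda>x. indicator H x * ?c x)"
      using integrable_mult_indicator[OF HM sq_int_imp_integrable[OF c]] by simp
    have m: "(\<lambda>x. indicator H x * ?m x) \<in> borel_measurable F" using H by measurable
    have 2: "integrable M (\<lambda>x. indicator H x * ?m x)"
      by (rule integrable_const_bound[where B = "real k", OF _ measurable_from_subalg[OF F m]])
         (auto simp: H_def indicator_def)
    have "AE x in M. real_cond_exp M F (\<lambda>x. indicator H x * a x) x = indicator H x * ?m x"
      by (rule real_cond_exp_mult_indicator[OF F H a])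
    moreover have "AE x in M. real_cond_exp M F (\<lambda>x. indicator H x * a x) x =
       real_cond_exp M F (\<lambda>x. indicator H x * ?c x) x + real_cond_exp M F (\<lambda>x. indicator H x * ?m x) x"
      using F.real_cond_exp_add[OF 1 2] by (simp add: algebra_simps)
    moreover have "AE x in M. real_cond_exp M F (\<lambda>x. indicator H x * ?m x) x = indicator H x * ?m x"
      by (rule F.real_cond_exp_F_meas[OF 2 m])
    moreover have "AE x in M. real_cond_exp M F (\<lambda>x. indicator H x * ?c x) x =
        indicator H x * real_cond_exp M F ?c x"
      by (rule real_cond_exp_mult_indicator[OF F H]) simp
    ultimately show ?thesis
      using AE_space by eventually_elim (auto simp: H_def sp)
  qed
  then have "AE x in M. \<forall>k::nat. \<bar>?m x\<bar> \<le> real k \<longrightarrow> real_cond_exp M F ?c x = 0"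
    unfolding AE_all_countable by blast
  then show ?thesis
    by eventually_elim (meson real_arch_simple)
qed

text \<open>By the tower property the expected conditional variances are squared norms of the
  centered functions, and the expected conditional covariance is their inner product. The
  correlation is thus the cosine of an angle between square-integrable functions, even if
  \<open>a\<close> and \<open>b\<close> themselves are not integrable.\<close>

lemma cond_corr_eq_centered:
  assumes F: "subalgebra M F"
    and a: "a \<in> borel_measurable M" "expected_cond_var M F a < \<infinity>"
    and b: "b \<in> borel_measurable M" "expected_cond_var M F b < \<infinity>"
  defines "a' \<equiv> \<lambda>x. a x - real_cond_exp M F a x" and "b' \<equiv> \<lambda>x. b x - real_cond_exp M F b x"
  shows "sq_int M a'" "sq_int M b'"
    "AE x in M. real_cond_exp M F a' x = 0" "AE x in M. real_cond_exp M F b' x = 0"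
    "cond_corr M F a b = (if l2norm M a' * l2norm M b' > 0
      then (\<integral>x. a' x * b' x \<partial>M) / (l2norm M a' * l2norm M b') else 0)"
proof -
  interpret F: sigma_finite_subalgebra M F
    by (rule sigma_finite_subalgebra_if_subalgebra[OF F])
  have *: "sq_int M (\<lambda>x. c x - real_cond_exp M F c x) \<and>
      expected_cond_var M F c = ennreal ((l2norm M (\<lambda>x. c x - real_cond_exp M F c x))\<^sup>2)"
    if [measurable]: "c \<in> borel_measurable M" and "expected_cond_var M F c < \<infinity>" for c
  proof -
    let ?d = "\<lambda>x. c x - real_cond_exp M F c x"
    have e: "expected_cond_var M F c = (\<integral>\<^sup>+x. ennreal ((?d x)\<^sup>2) \<partial>M)"
      using F by (rule expected_cond_var_eq) simp
    then have i: "integrable M (\<lambda>x. (?d x)\<^sup>2)"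
      using that by (intro integrableI_bounded) auto
    then have "expected_cond_var M F c = ennreal (\<integral>x. (?d x)\<^sup>2 \<partial>M)"
      unfolding e by (rule nn_integral_eq_integral) simp
    with i show ?thesis by (auto simp: sq_int_def l2norm_power2)
  qed
  show sq: "sq_int M a'" "sq_int M b'" unfolding a'_def b'_def using * a b by auto
  show "AE x in M. real_cond_exp M F a' x = 0" "AE x in M. real_cond_exp M F b' x = 0"
    using real_cond_exp_centered_sq_int[OF F] a b sq unfolding a'_def b'_def by auto
  have ea: "expected_cond_var M F a = ennreal ((l2norm M a')\<^sup>2)"
    and eb: "expected_cond_var M F b = ennreal ((l2norm M b')\<^sup>2)"
    unfolding a'_def b'_def using * a b by auto
  have "(\<integral>x. cond_cov M F a b x \<partial>M) = (\<integral>x. a' x * b' x \<partial>M)"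
    unfolding cond_cov_def a'_def[symmetric] b'_def[symmetric]
    using sq_int_integrable_mult[OF sq] unfolding a'_def b'_def by (rule F.real_cond_exp_int)
  moreover have "ennreal ((l2norm M a')\<^sup>2) * ennreal ((l2norm M b')\<^sup>2) > 0 \<longleftrightarrow>
      l2norm M a' * l2norm M b' > 0"
    using l2norm_nonneg[of M a'] l2norm_nonneg[of M b']
    by (auto simp: ennreal_mult[symmetric] power_mult_distrib[symmetric] less_le)
  ultimately show "cond_corr M F a b = (if l2norm M a' * l2norm M b' > 0
      then (\<integral>x. a' x * b' x \<partial>M) / (l2norm M a' * l2norm M b') else 0)"
    unfolding cond_corr_def ea eb by simp
qed

text \<open>The bound can be applied to the centered functions because \<open>A\<close> and
  \<open>B\<close> contain \<open>F\<close>, so that subtracting an \<open>F\<close>-measurable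
  function preserves measurability. This corresponds to \<open>f\<close> and \<open>g\<close> having
  \<open>U\<close> as an argument.\<close>

lemma cond_corr_le_mc_bound:
  assumes F: "subalgebra M F" "subalgebra A F" "subalgebra B F" "subalgebra M A" "subalgebra M B"
    and mc: "mc_bound M F A B r" and r: "0 \<le> r"
    and a: "a \<in> borel_measurable A" "expected_cond_var M F a < \<infinity>"
    and b: "b \<in> borel_measurable B" "expected_cond_var M F b < \<infinity>"
  shows "cond_corr M F a b \<le> r"
proof -
  have aM: "a \<in> borel_measurable M" and bM: "b \<in> borel_measurable M"
    using a b F measurable_from_subalg by blast+
  let ?a = "\<lambda>x. a x - real_cond_exp M F a x" and ?b = "\<lambda>x. b x - real_cond_exp M F b x"
  note c = cond_corr_eq_centered[OF F(1) aM a(2) bM b(2)]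
  have "real_cond_exp M F a \<in> borel_measurable A" "real_cond_exp M F b \<in> borel_measurable B"
    using F measurable_from_subalg borel_measurable_cond_exp by blast+
  then have "?a \<in> borel_measurable A" "?b \<in> borel_measurable B"
    using a b by auto
  then have "(\<integral>x. ?a x * ?b x \<partial>M) \<le> r * (l2norm M ?a * l2norm M ?b)"
    using c by (intro mc_boundD[OF mc]) auto
  then show ?thesis
    unfolding c(5) using r by (auto simp: divide_le_eq)
qed

text \<open>Together the three parts identify the maximal correlation as the least nonnegative
  \<open>r\<close> with \<open>mc_bound M F A B r\<close>. The definition by a supremum is used
  nowhere else.\<close>

lemma cond_max_corr_mc_bound:
  fixes X :: "'a \<Rightarrow> 'b" and Y :: "'a \<Rightarrow> 'c" and U :: "'a \<Rightarrow> real"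
  assumes X: "X \<in> measurable M S" and Y: "Y \<in> measurable M T" and U: "U \<in> borel_measurable M"
  defines "F \<equiv> sigma_of M U"
    and "A \<equiv> vimage_algebra (space M) (\<lambda>x. (X x, U x)) (S \<Otimes>\<^sub>M borel)"
    and "B \<equiv> vimage_algebra (space M) (\<lambda>x. (Y x, U x)) (T \<Otimes>\<^sub>M borel)"
  shows "0 \<le> cond_max_corr M S X T Y U"
    and "mc_bound M F A B (cond_max_corr M S X T Y U)"
    and "\<And>r. 0 \<le> r \<Longrightarrow> mc_bound M F A B r \<Longrightarrow> cond_max_corr M S X T Y U \<le> r"
proof -
  have XU: "(\<lambda>x. (X x, U x)) \<in> measurable M (S \<Otimes>\<^sub>M borel)"
    and YU: "(\<lambda>x. (Y x, U x)) \<in> measurable M (T \<Otimes>\<^sub>M borel)"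
    using X Y U by measurable
  have XA: "(\<lambda>x. (X x, U x)) \<in> measurable A (S \<Otimes>\<^sub>M borel)"
    and YB: "(\<lambda>x. (Y x, U x)) \<in> measurable B (T \<Otimes>\<^sub>M borel)"
    unfolding A_def B_def using measurable_space[OF XU] measurable_space[OF YU]
    by (auto intro!: measurable_vimage_algebra1)
  have F: "subalgebra M F" and A: "subalgebra M A" and B: "subalgebra M B"
    unfolding F_def A_def B_def sigma_of_def
    using U XU YU by (auto intro: subalgebra_vimage_algebra)
  have UA: "U \<in> borel_measurable A" and UB: "U \<in> borel_measurable B"
    using measurable_compose[OF XA measurable_snd] measurable_compose[OF YB measurable_snd] by auto
  have sp: "space A = space M" "space B = space M" "space F = space M"
    by (auto simp: A_def B_def F_def sigma_of_def)
  have AF: "subalgebra A F" and BF: "subalgebra B F"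
    using subalgebra_vimage_algebra[OF UA] subalgebra_vimage_algebra[OF UB]
    by (simp_all add: sp F_def sigma_of_def)
  define V where "V = {cond_corr M F (\<lambda>\<omega>. f (X \<omega>, U \<omega>)) (\<lambda>\<omega>. g (Y \<omega>, U \<omega>)) | f g.
      f \<in> borel_measurable (S \<Otimes>\<^sub>M borel) \<and>
      g \<in> borel_measurable (T \<Otimes>\<^sub>M borel) \<and>
      expected_cond_var M F (\<lambda>\<omega>. f (X \<omega>, U \<omega>)) < \<infinity> \<and>
      expected_cond_var M F (\<lambda>\<omega>. g (Y \<omega>, U \<omega>)) < \<infinity>}"
  have S: "cond_max_corr M S X T Y U = Sup V"
    by (simp add: cond_max_corr_def V_def F_def)
  have le: "v \<le> r" if r: "0 \<le> r" and mc: "mc_bound M F A B r" and v: "v \<in> V" for r v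
    using v measurable_compose[OF XA] measurable_compose[OF YB] unfolding V_def
    by (auto intro!: cond_corr_le_mc_bound[OF F AF BF A B mc r])
  have V: "bdd_above V"
    using le[OF _ mc_bound_1] by (intro bdd_aboveI[of _ 1]) auto
  \<comment> \<open>The zero functions are degenerate, so their correlation is 0 by convention. This
    makes \<open>V\<close> nonempty and its supremum nonnegative.\<close>
  have V0: "0 \<in> V"
  proof -
    have "AE x in M. real_cond_exp M F (\<lambda>x. 0) x = 0"
      using sigma_finite_subalgebra.real_cond_exp_F_meas[OF sigma_finite_subalgebra_if_subalgebra[OF F], of "\<lambda>x. 0"]
      by simp
    then have "expected_cond_var M F (\<lambda>x. 0) = 0"
      by (subst expected_cond_var_eq[OF F]) (auto simp: nn_integral_0_iff_AE)
    moreover then have "cond_corr M F (\<lambda>x. 0) (\<lambda>x. 0) = 0" by (simp add: cond_corr_def)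
    ultimately show ?thesis
      unfolding V_def by (intro CollectI exI[of _ "\<lambda>_. 0"]) auto
  qed
  show "0 \<le> cond_max_corr M S X T Y U"
    unfolding S using V0 V by (rule cSup_upper)
  show "cond_max_corr M S X T Y U \<le> r" if "0 \<le> r" "mc_bound M F A B r" for r
    unfolding S using V0 le[OF that] by (intro cSup_least) auto
  show "mc_bound M F A B (cond_max_corr M S X T Y U)"
    unfolding mc_bound_def
  proof safe
    fix a b
    assume a: "sq_int M a" "a \<in> borel_measurable A" and a0: "AE x in M. real_cond_exp M F a x = 0"
      and b: "sq_int M b" "b \<in> borel_measurable B" and b0: "AE x in M. real_cond_exp M F b x = 0"
    obtain f where f: "f \<in> borel_measurable (S \<Otimes>\<^sub>M borel)" "\<And>x. x \<in> space M \<Longrightarrow> a x = f (X x, U x)"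
      using borel_measurable_vimage_algebra_factorization[of _ _ _ a, OF _ a(2)[unfolded A_def]]
        measurable_space[OF XU] by blast
    obtain g where g: "g \<in> borel_measurable (T \<Otimes>\<^sub>M borel)" "\<And>x. x \<in> space M \<Longrightarrow> b x = g (Y x, U x)"
      using borel_measurable_vimage_algebra_factorization[of _ _ _ b, OF _ b(2)[unfolded B_def]]
        measurable_space[OF YU] by blast
    let ?f = "\<lambda>x. f (X x, U x)" and ?g = "\<lambda>x. g (Y x, U x)"
    \<comment> \<open>A function that agrees almost everywhere with a centered one equals its own
      centering almost everywhere. Hence the centering built into \<open>cond_corr\<close> does not
      change the factored copies of \<open>a\<close> and \<open>b\<close>.\<close>
    have *: "(AE x in M. c x = d x - real_cond_exp M F d x) \<and> expected_cond_var M F d < \<infinity>"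
      if c: "sq_int M c" "AE x in M. real_cond_exp M F c x = 0"
        and d: "d \<in> borel_measurable M" "AE x in M. c x = d x" for c d
    proof -
      have "AE x in M. real_cond_exp M F c x = real_cond_exp M F d x"
        by (rule sigma_finite_subalgebra.real_cond_exp_cong[OF sigma_finite_subalgebra_if_subalgebra[OF F] d(2)])
          (use c d in auto)
      with c(2) d(2) have eq: "AE x in M. c x = d x - real_cond_exp M F d x"
        by eventually_elim simp
      then have "expected_cond_var M F d = (\<integral>\<^sup>+x. ennreal ((c x)\<^sup>2) \<partial>M)"
        unfolding expected_cond_var_eq[OF F d(1)] by (intro nn_integral_cong_AE) auto
      also have "\<dots> < \<infinity>"
        using sq_int_integrable_power2[OF c(1)] by (auto simp: integrable_iff_bounded)
      finally show ?thesis using eq by simp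
    qed
    have fM: "?f \<in> borel_measurable M" and gM: "?g \<in> borel_measurable M"
      using measurable_compose[OF XU f(1)] measurable_compose[OF YU g(1)] by auto
    have fa: "AE x in M. a x = ?f x - real_cond_exp M F ?f x" "expected_cond_var M F ?f < \<infinity>"
      using *[OF a(1) a0 fM] f(2) by auto
    have gb: "AE x in M. b x = ?g x - real_cond_exp M F ?g x" "expected_cond_var M F ?g < \<infinity>"
      using *[OF b(1) b0 gM] g(2) by auto
    have "cond_corr M F ?f ?g \<in> V" unfolding V_def using f(1) g(1) fa(2) gb(2) by blast
    then have "cond_corr M F ?f ?g \<le> Sup V" using V by (rule cSup_upper)
    moreover have "cond_corr M F ?f ?g = (if l2norm M a * l2norm M b > 0
      then (\<integral>x. a x * b x \<partial>M) / (l2norm M a * l2norm M b) else 0)"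
    proof -
      have "l2norm M a = l2norm M (\<lambda>x. ?f x - real_cond_exp M F ?f x)"
        by (rule l2norm_cong_AE[OF fa(1)]) (use a fM in auto)
      moreover have "l2norm M b = l2norm M (\<lambda>x. ?g x - real_cond_exp M F ?g x)"
        by (rule l2norm_cong_AE[OF gb(1)]) (use b gM in auto)
      moreover have "(\<integral>x. a x * b x \<partial>M) =
         (\<integral>x. (?f x - real_cond_exp M F ?f x) * (?g x - real_cond_exp M F ?g x) \<partial>M)"
        using fa(1) gb(1) a(1) b(1) fM gM by (intro integral_cong_AE) auto
      ultimately show ?thesis
        using cond_corr_eq_centered(5)[OF F fM fa(2) gM gb(2)] by simp
    qed
    \<comment> \<open>Settles the case where a norm is 0: there \<open>cond_corr\<close> is 0 by
      convention and carries no information on the integral.\<close>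
    moreover have "(\<integral>x. a x * b x \<partial>M) \<le> l2norm M a * l2norm M b"
      using integral_Cauchy_Schwarz[OF a(1) b(1)] by simp
    ultimately show "(\<integral>x. a x * b x \<partial>M) \<le> cond_max_corr M S X T Y U * (l2norm M a * l2norm M b)"
      unfolding S using l2norm_nonneg[of M a] l2norm_nonneg[of M b]
      by (cases "l2norm M a * l2norm M b > 0") (auto simp: divide_le_eq less_le)
  qed
qed

end

section \<open>Conditionally independent sigma-algebras\<close>

lemma sum_indicator_mult_sum_indicator:
  fixes a b :: "'i \<Rightarrow> real"
  assumes "finite P" "disjoint_family_on C P"
  shows "(\<Sum>p\<in>P. a p * indicator (C p) x) * (\<Sum>p\<in>P. b p * indicator (C p) x)
    = (\<Sum>p\<in>P. a p * b p * indicator (C p) x)"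
proof -
  have "(\<Sum>q\<in>P. (a p * indicator (C p) x) * (b q * indicator (C q) x)) = a p * b p * indicator (C p) x"
    if p: "p \<in> P" for p
  proof -
    have "(\<Sum>q\<in>P. (a p * indicator (C p) x) * (b q * indicator (C q) x))
        = (\<Sum>q\<in>P. if q = p then a p * b p * indicator (C p) x else 0)"
      using assms(2) p
      by (intro sum.cong refl) (auto simp: disjoint_family_on_def indicator_def)
    then show ?thesis using assms(1) p by simp
  qed
  then show ?thesis by (simp add: sum_product cong: sum.cong)
qed

context prob_space
begin

lemma real_cond_exp_indicator_bounds:
  assumes F: "subalgebra M F" and C: "C \<in> sets M"
  shows "AE x in M. 0 \<le> real_cond_exp M F (indicator C) x \<and> real_cond_exp M F (indicator C) x \<le> 1"
proof -
  interpret F: sigma_finite_subalgebra M F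
    by (rule sigma_finite_subalgebra_if_subalgebra[OF F])
  have i: "integrable M (indicator C :: 'a \<Rightarrow> real)"
    by (rule sq_int_imp_integrable[OF sq_int_indicator[OF C]])
  have "AE x in M. 0 \<le> real_cond_exp M F (indicator C) x"
    using i by (intro F.real_cond_exp_ge_c) auto
  moreover have "AE x in M. real_cond_exp M F (indicator C) x \<le> 1"
    using i by (intro F.real_cond_exp_le_c) (auto simp: indicator_def)
  ultimately show ?thesis by eventually_elim simp
qed

lemma integrable_mult_real_cond_exp_indicator:
  assumes F: "subalgebra M F" and C: "C \<in> sets M" and c: "integrable M c"
  shows "integrable M (\<lambda>x. real_cond_exp M F (indicator C) x * c x)"
proof (rule Bochner_Integration.integrable_bound[OF c])
  show "AE x in M. norm (real_cond_exp M F (indicator C) x * c x) \<le> norm (c x)"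
    using real_cond_exp_indicator_bounds[OF F C]
    by eventually_elim (auto simp: abs_mult mult_left_le_one_le)
qed (use c in measurable)

text \<open>Both sides equal the integral of the product of the two conditional
  expectations.\<close>

lemma real_cond_exp_self_adjoint:
  assumes F: "subalgebra M F" and C: "C \<in> sets M" and c: "integrable M c"
  shows "(\<integral>x. real_cond_exp M F c x * indicator C x \<partial>M)
    = (\<integral>x. c x * real_cond_exp M F (indicator C) x \<partial>M)"
proof -
  interpret F: sigma_finite_subalgebra M F
    by (rule sigma_finite_subalgebra_if_subalgebra[OF F])
  let ?p = "real_cond_exp M F (indicator C)"
  have i: "integrable M (\<lambda>x. real_cond_exp M F c x * indicator C x)"
    using integrable_mult_indicator[OF C F.real_cond_exp_int(1)[OF c]] by (simp add: mult.commute)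
  have "(\<integral>x. real_cond_exp M F c x * indicator C x \<partial>M) = (\<integral>x. real_cond_exp M F c x * ?p x \<partial>M)"
    using F.real_cond_exp_intg(2)[OF i] C by simp
  also have "\<dots> = (\<integral>x. ?p x * c x \<partial>M)"
    using F.real_cond_exp_intg(2)[OF integrable_mult_real_cond_exp_indicator[OF F C c]] c
    by (simp add: mult.commute)
  finally show ?thesis by (simp add: mult.commute)
qed

end

text \<open>Conditional independence in its predictive form: as \<open>G2\<close> contains
  \<open>F\<close>, the equation says that knowing \<open>G2\<close> on top of \<open>F\<close> does
  not change the prediction of a \<open>G1\<close>-measurable function. In contrast to the product
  formula for events, it applies to integrable functions directly.\<close>

locale cond_indep_algebras = prob_space M for M :: "'a measure" +
  fixes F G1 G2 :: "'a measure"
  assumes subalgebras: "subalgebra M F" "subalgebra M G1" "subalgebra M G2"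
      "subalgebra G1 F" "subalgebra G2 F"
    and real_cond_exp_indep: "\<And>a. a \<in> borel_measurable G1 \<Longrightarrow> integrable M a \<Longrightarrow>
      AE x in M. real_cond_exp M G2 a x = real_cond_exp M F a x"
begin

sublocale F: sigma_finite_subalgebra M F
  by (rule sigma_finite_subalgebra_if_subalgebra[OF subalgebras(1)])

sublocale G2: sigma_finite_subalgebra M G2
  by (rule sigma_finite_subalgebra_if_subalgebra[OF subalgebras(3)])

lemma real_cond_exp_sum_eq_0:
  assumes "\<And>i. i \<in> I \<Longrightarrow> sq_int M (f i)" "\<And>i. i \<in> I \<Longrightarrow> AE x in M. real_cond_exp M F (f i) x = 0"
  shows "AE x in M. real_cond_exp M F (\<lambda>x. \<Sum>i\<in>I. f i x) x = 0"
  using assms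
proof (induction I rule: infinite_finite_induct)
  case (insert i I)
  have "AE x in M. real_cond_exp M F (\<lambda>x. f i x + (\<Sum>i\<in>I. f i x)) x
      = real_cond_exp M F (f i) x + real_cond_exp M F (\<lambda>x. \<Sum>i\<in>I. f i x) x"
    using insert by (intro F.real_cond_exp_add sq_int_imp_integrable sq_int_sum) auto
  moreover have "AE x in M. real_cond_exp M F (f i) x = 0" using insert by auto
  moreover have "AE x in M. real_cond_exp M F (\<lambda>x. \<Sum>i\<in>I. f i x) x = 0" using insert by auto
  ultimately have "AE x in M. real_cond_exp M F (\<lambda>x. f i x + (\<Sum>i\<in>I. f i x)) x = 0"
    by eventually_elim simp
  then show ?case using insert by simp
qed (use F.real_cond_exp_F_meas[of "\<lambda>x. 0"] in auto)

text \<open>Conditioning on \<open>G2\<close> gives the same as conditioning on \<open>F\<close>,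
  namely 0. So a centered function of the first block is orthogonal to every square-integrable
  function of the second block, not only to those of \<open>F\<close>.\<close>

lemma integral_mult_eq_0:
  assumes a: "sq_int M a" "a \<in> borel_measurable G1" "AE x in M. real_cond_exp M F a x = 0"
    and v: "sq_int M v" "v \<in> borel_measurable G2"
  shows "(\<integral>x. a x * v x \<partial>M) = 0"
proof (rule integral_mult_eq_0_if_real_cond_exp_eq_0[OF subalgebras(3) a(1) _ v])
  show "AE x in M. real_cond_exp M G2 a x = 0"
    using real_cond_exp_indep[OF a(2) sq_int_imp_integrable[OF a(1)]] a(3) by eventually_elim simp
qed

text \<open>Conditional independence replaces \<open>c\<close> by its conditional expectation given
  \<open>F\<close>; self-adjointness then moves the conditioning from \<open>c\<close> to the
  indicator.\<close>

lemma integral_mult_indicator: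
  assumes c: "c \<in> borel_measurable G1" "integrable M c" and C: "C \<in> sets G2"
  shows "(\<integral>x. c x * indicator C x \<partial>M) = (\<integral>x. c x * real_cond_exp M F (indicator C) x \<partial>M)"
proof -
  have CM: "C \<in> sets M" using C subalgebras(3) by (auto simp: subalgebra_def)
  have i: "integrable M (\<lambda>x. indicator C x * c x)"
    using integrable_mult_indicator[OF CM c(2)] by simp
  have "(\<integral>x. c x * indicator C x \<partial>M) = (\<integral>x. indicator C x * real_cond_exp M G2 c x \<partial>M)"
    using G2.real_cond_exp_intg(2)[OF i] C c by (simp add: mult.commute)
  also have "\<dots> = (\<integral>x. real_cond_exp M F c x * indicator C x \<partial>M)"
    using real_cond_exp_indep[OF c] CM by (intro integral_cong_AE) (auto simp: mult.commute)
  finally show ?thesis by (simp add: real_cond_exp_self_adjoint[OF subalgebras(1) CM c(2)])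
qed

text \<open>The square root of the conditional probability of \<open>C\<close> is an \<open>F\<close>-measurable weight, so it
  can be absorbed into \<open>a\<close> and \<open>b\<close>.\<close>

lemma mc_bound_mult_indicator:
  assumes sub: "subalgebra G1 A" "subalgebra G1 B" "subalgebra A F" "subalgebra B F"
    and mc: "mc_bound M F A B r" and C: "C \<in> sets G2"
    and a: "sq_int M a" "a \<in> borel_measurable A" "AE x in M. real_cond_exp M F a x = 0"
    and b: "sq_int M b" "b \<in> borel_measurable B" "AE x in M. real_cond_exp M F b x = 0"
  shows "(\<integral>x. a x * b x * indicator C x \<partial>M)
    \<le> r * (l2norm M (\<lambda>x. a x * indicator C x) * l2norm M (\<lambda>x. b x * indicator C x))"
proof -
  let ?p = "real_cond_exp M F (indicator C)"
  define s where "s = (\<lambda>x. sqrt (?p x))"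
  have CM: "C \<in> sets M" using C subalgebras(3) by (auto simp: subalgebra_def)
  have s[measurable]: "s \<in> borel_measurable F" unfolding s_def by measurable
  have sM: "s \<in> borel_measurable M" by (rule measurable_from_subalg[OF subalgebras(1) s])
  have sb: "AE x in M. 0 \<le> s x \<and> s x \<le> 1 \<and> s x * s x = ?p x"
    using real_cond_exp_indicator_bounds[OF subalgebras(1) CM] by eventually_elim (simp add: s_def)
  have weight: "(\<integral>x. (c x * d x) * indicator C x \<partial>M) = (\<integral>x. (s x * c x) * (s x * d x) \<partial>M)"
    if "sq_int M c" "c \<in> borel_measurable G1" "sq_int M d" "d \<in> borel_measurable G1" for c d
  proof -
    have "(\<integral>x. (c x * d x) * indicator C x \<partial>M) = (\<integral>x. (c x * d x) * ?p x \<partial>M)"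
      using that by (intro integral_mult_indicator C sq_int_integrable_mult) auto
    also have "\<dots> = (\<integral>x. (s x * c x) * (s x * d x) \<partial>M)"
    proof (rule integral_cong_AE)
      show "AE x in M. (c x * d x) * ?p x = (s x * c x) * (s x * d x)"
        using sb by eventually_elim (metis mult.assoc mult.commute)
    qed (use that sM in auto)
    finally show ?thesis .
  qed
  have *: "sq_int M (\<lambda>x. s x * c x) \<and> (\<lambda>x. s x * c x) \<in> borel_measurable A'
      \<and> (AE x in M. real_cond_exp M F (\<lambda>x. s x * c x) x = 0)
      \<and> l2norm M (\<lambda>x. s x * c x) = l2norm M (\<lambda>x. c x * indicator C x)"
    if A': "subalgebra G1 A'" "subalgebra A' F"
    and c: "sq_int M c" "c \<in> borel_measurable A'" "AE x in M. real_cond_exp M F c x = 0" for c A'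
  proof -
    have sc: "sq_int M (\<lambda>x. s x * c x)"
    proof (rule sq_int_bound[OF c(1)])
      show "AE x in M. \<bar>s x * c x\<bar> \<le> \<bar>c x\<bar>"
        using sb by eventually_elim (auto simp: abs_mult mult_left_le_one_le)
    qed (use c sM in auto)
    have "s \<in> borel_measurable A'" by (rule measurable_from_subalg[OF A'(2) s])
    then have m: "(\<lambda>x. s x * c x) \<in> borel_measurable A'" using c(2) by auto
    have "AE x in M. real_cond_exp M F (\<lambda>x. s x * c x) x = s x * real_cond_exp M F c x"
      using sq_int_imp_integrable[OF sc] c(1) by (intro F.real_cond_exp_mult s) auto
    with c(3) have z: "AE x in M. real_cond_exp M F (\<lambda>x. s x * c x) x = 0"
      by eventually_elim simp
    have "c \<in> borel_measurable G1" by (rule measurable_from_subalg[OF A'(1) c(2)])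
    \<comment> \<open>With equal factors, \<open>weight\<close> converts the norm of
      \<open>s * c\<close> back into the norm of \<open>c\<close> on the cell \<open>C\<close>. The
      conditional probability therefore disappears from the final bound.\<close>
    from weight[OF c(1) this c(1) this]
    have "(\<integral>x. (s x * c x)\<^sup>2 \<partial>M) = (\<integral>x. (c x * c x) * indicator C x \<partial>M)"
      by (simp add: power2_eq_square)
    also have "\<dots> = (\<integral>x. (c x * indicator C x)\<^sup>2 \<partial>M)"
      by (intro Bochner_Integration.integral_cong) (auto simp: power2_eq_square indicator_def)
    finally have "l2norm M (\<lambda>x. s x * c x) = l2norm M (\<lambda>x. c x * indicator C x)"
      by (simp add: l2norm_def)
    with sc m z show ?thesis by blast
  qed
  have "(\<integral>x. a x * b x * indicator C x \<partial>M) = (\<integral>x. (s x * a x) * (s x * b x) \<partial>M)"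
    by (intro weight a b measurable_from_subalg[OF sub(1)] measurable_from_subalg[OF sub(2)])
  also have "\<dots> \<le> r * (l2norm M (\<lambda>x. s x * a x) * l2norm M (\<lambda>x. s x * b x))"
    using *[OF sub(1,3) a] *[OF sub(2,4) b] by (intro mc_boundD[OF mc]) auto
  finally show ?thesis using *[OF sub(1,3) a] *[OF sub(2,4) b] by simp
qed

text \<open>On disjoint cells the integral and both squared norms are sums over the cells. The bound
  on each cell is followed by the discrete Cauchy-Schwarz inequality for the vectors of cell norms;
  multiplying it by \<open>r\<close> uses \<open>0 \<le> r\<close>.\<close>

lemma mc_bound_sum_disjoint:
  assumes sub: "subalgebra G1 A" "subalgebra G1 B" "subalgebra A F" "subalgebra B F"
    and mc: "mc_bound M F A B r" and r: "0 \<le> r"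
    and P: "finite P" "disjoint_family_on C P" "\<And>p. p \<in> P \<Longrightarrow> C p \<in> sets G2"
    and a: "\<And>p. p \<in> P \<Longrightarrow> sq_int M (a p)" "\<And>p. p \<in> P \<Longrightarrow> a p \<in> borel_measurable A"
      "\<And>p. p \<in> P \<Longrightarrow> AE x in M. real_cond_exp M F (a p) x = 0"
    and b: "\<And>p. p \<in> P \<Longrightarrow> sq_int M (b p)" "\<And>p. p \<in> P \<Longrightarrow> b p \<in> borel_measurable B"
      "\<And>p. p \<in> P \<Longrightarrow> AE x in M. real_cond_exp M F (b p) x = 0"
  shows "(\<integral>x. (\<Sum>p\<in>P. a p x * indicator (C p) x) * (\<Sum>p\<in>P. b p x * indicator (C p) x) \<partial>M)
    \<le> r * (l2norm M (\<lambda>x. \<Sum>p\<in>P. a p x * indicator (C p) x) * l2norm M (\<lambda>x. \<Sum>p\<in>P. b p x * indicator (C p) x))"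
proof -
  let ?x = "\<lambda>p. l2norm M (\<lambda>x. a p x * indicator (C p) x)"
  let ?y = "\<lambda>p. l2norm M (\<lambda>x. b p x * indicator (C p) x)"
  have CM: "C p \<in> sets M" if "p \<in> P" for p
    using P(3)[OF that] subalgebras(3) by (auto simp: subalgebra_def)
  have split: "(\<integral>x. (\<Sum>p\<in>P. c p x * indicator (C p) x) * (\<Sum>p\<in>P. d p x * indicator (C p) x) \<partial>M)
      = (\<Sum>p\<in>P. \<integral>x. c p x * d p x * indicator (C p) x \<partial>M)"
    if "\<And>p. p \<in> P \<Longrightarrow> sq_int M (c p)" "\<And>p. p \<in> P \<Longrightarrow> sq_int M (d p)" for c d :: "_ \<Rightarrow> 'a \<Rightarrow> real"
    unfolding sum_indicator_mult_sum_indicator[OF P(1,2)]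
    using integrable_mult_indicator[OF CM sq_int_integrable_mult[OF that]]
    by (intro Bochner_Integration.integral_sum) (simp add: mult.commute)
  have norm: "l2norm M (\<lambda>x. \<Sum>p\<in>P. c p x * indicator (C p) x)
      = L2_set (\<lambda>p. l2norm M (\<lambda>x. c p x * indicator (C p) x)) P"
    if "\<And>p. p \<in> P \<Longrightarrow> sq_int M (c p)" for c :: "_ \<Rightarrow> 'a \<Rightarrow> real"
  proof -
    have sq: "(c p x)\<^sup>2 * indicator (C p) x = (c p x * indicator (C p) x)\<^sup>2" for p x
      by (auto simp: indicator_def power2_eq_square)
    have "(\<integral>x. (\<Sum>p\<in>P. c p x * indicator (C p) x)\<^sup>2 \<partial>M)
        = (\<Sum>p\<in>P. \<integral>x. (c p x * indicator (C p) x)\<^sup>2 \<partial>M)"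
      using split[of c c, OF that that] unfolding power2_eq_square[symmetric] sq by simp
    then show ?thesis
      by (simp add: l2norm_def[of M "\<lambda>x. \<Sum>p\<in>P. c p x * indicator (C p) x"] L2_set_def l2norm_power2)
  qed
  have "(\<integral>x. (\<Sum>p\<in>P. a p x * indicator (C p) x) * (\<Sum>p\<in>P. b p x * indicator (C p) x) \<partial>M)
      = (\<Sum>p\<in>P. \<integral>x. a p x * b p x * indicator (C p) x \<partial>M)"
    by (rule split[OF a(1) b(1)])
  also have "\<dots> \<le> (\<Sum>p\<in>P. r * (?x p * ?y p))"
    by (intro sum_mono mc_bound_mult_indicator[OF sub mc] P a b)
  also have "\<dots> \<le> r * (L2_set ?x P * L2_set ?y P)"
    using L2_set_mult_ineq[of ?x ?y P] r by (simp add: sum_distrib_left[symmetric] mult_left_mono)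
  finally show ?thesis by (simp add: norm a b)
qed

text \<open>One partition has to serve both sums. The cell \<open>Q (S, T)\<close> consists of the
  points whose memberships in the \<open>C k\<close> and \<open>D k\<close> are exactly those listed
  in \<open>S\<close> and \<open>T\<close>. There the sums have the coefficients
  \<open>a' (S, T)\<close> and \<open>b' (S, T)\<close>, which are finite sums of centered functions
  and so again centered.\<close>

lemma mc_bound_sum:
  fixes a b :: "nat \<Rightarrow> 'a \<Rightarrow> real"
  assumes sub: "subalgebra G1 A" "subalgebra G1 B" "subalgebra A F" "subalgebra B F"
    and mc: "mc_bound M F A B r" and r: "0 \<le> r"
    and a: "\<And>k. k < m \<Longrightarrow> sq_int M (a k)" "\<And>k. k < m \<Longrightarrow> a k \<in> borel_measurable A"
      "\<And>k. k < m \<Longrightarrow> AE x in M. real_cond_exp M F (a k) x = 0"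
    and C: "\<And>k. k < m \<Longrightarrow> C k \<in> sets G2"
    and b: "\<And>k. k < n \<Longrightarrow> sq_int M (b k)" "\<And>k. k < n \<Longrightarrow> b k \<in> borel_measurable B"
      "\<And>k. k < n \<Longrightarrow> AE x in M. real_cond_exp M F (b k) x = 0"
    and D: "\<And>k. k < n \<Longrightarrow> D k \<in> sets G2"
  shows "(\<integral>x. (\<Sum>k<m. a k x * indicator (C k) x) * (\<Sum>k<n. b k x * indicator (D k) x) \<partial>M)
    \<le> r * (l2norm M (\<lambda>x. \<Sum>k<m. a k x * indicator (C k) x) * l2norm M (\<lambda>x. \<Sum>k<n. b k x * indicator (D k) x))"
proof -
  define P where "P = Pow {..<m} \<times> Pow {..<n}"
  define Q where "Q = (\<lambda>(S, T). {x \<in> space G2. (\<forall>k<m. x \<in> C k \<longleftrightarrow> k \<in> S) \<and> (\<forall>k<n. x \<in> D k \<longleftrightarrow> k \<in> T)})"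
  define a' where "a' = (\<lambda>(S, T :: nat set) x. \<Sum>k\<in>S. a k x)"
  define b' where "b' = (\<lambda>(S :: nat set, T) x. \<Sum>k\<in>T. b k x)"
  have P: "finite P" by (simp add: P_def)
  have sp: "space G2 = space M" using subalgebras by (simp add: subalgebra_def)
  have Q: "Q p \<in> sets G2" for p
    using C D by (cases p) (auto simp: Q_def intro!: sets.sets_Collect_conj sets.sets_Collect_finite_All'
        sets.sets_Collect_const)
  have "p = q" if "p \<in> P" "q \<in> P" "x \<in> Q p" "x \<in> Q q" for p q x
    using that by (auto simp: P_def Q_def)
  then have disj: "disjoint_family_on Q P" unfolding disjoint_family_on_def by blast
  have A: "sq_int M (a' p)" "a' p \<in> borel_measurable A" "AE x in M. real_cond_exp M F (a' p) x = 0"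
    if "p \<in> P" for p
    using that a unfolding P_def a'_def
    by (auto intro!: sq_int_sum borel_measurable_sum real_cond_exp_sum_eq_0)
  have B: "sq_int M (b' p)" "b' p \<in> borel_measurable B" "AE x in M. real_cond_exp M F (b' p) x = 0"
    if "p \<in> P" for p
    using that b unfolding P_def b'_def
    by (auto intro!: sq_int_sum borel_measurable_sum real_cond_exp_sum_eq_0)
  have *: "(\<Sum>p\<in>P. f p * indicator (Q p) x) = f ({k. k < m \<and> x \<in> C k}, {k. k < n \<and> x \<in> D k})"
    if x: "x \<in> space M" for x and f :: "_ \<Rightarrow> real"
  proof -
    let ?p = "({k. k < m \<and> x \<in> C k}, {k. k < n \<and> x \<in> D k})"
    have "x \<in> Q p \<longleftrightarrow> p = ?p" if "p \<in> P" for p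
      using that x by (auto simp: P_def Q_def sp)
    then have "(\<Sum>p\<in>P. f p * indicator (Q p) x) = (\<Sum>p\<in>P. if p = ?p then f p else 0)"
      by (intro sum.cong) (auto simp: indicator_def)
    also have "\<dots> = f ?p" using P by (auto simp: P_def)
    finally show ?thesis .
  qed
  have eqA: "(\<Sum>p\<in>P. a' p x * indicator (Q p) x) = (\<Sum>k<m. a k x * indicator (C k) x)"
    and eqB: "(\<Sum>p\<in>P. b' p x * indicator (Q p) x) = (\<Sum>k<n. b k x * indicator (D k) x)"
    if "x \<in> space M" for x
    using *[OF that, of "\<lambda>p. a' p x"] *[OF that, of "\<lambda>p. b' p x"]
    by (auto simp: a'_def b'_def indicator_def sum.If_cases Int_def intro!: sum.mono_neutral_cong_left)
  have "(\<integral>x. (\<Sum>p\<in>P. a' p x * indicator (Q p) x) * (\<Sum>p\<in>P. b' p x * indicator (Q p) x) \<partial>M)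
    \<le> r * (l2norm M (\<lambda>x. \<Sum>p\<in>P. a' p x * indicator (Q p) x) * l2norm M (\<lambda>x. \<Sum>p\<in>P. b' p x * indicator (Q p) x))"
    by (intro mc_bound_sum_disjoint[OF sub mc r P disj] Q A B)
  then show ?thesis
    unfolding l2norm_def by (simp add: eqA eqB cong: Bochner_Integration.integral_cong)
qed

end

section \<open>Approximation in mean square\<close>

lemma l2norm_cmult: "l2norm M (\<lambda>x. c * f x) = \<bar>c\<bar> * l2norm M f"
  by (simp add: l2norm_def power_mult_distrib real_sqrt_mult)

lemma l2norm_triangle:
  assumes "sq_int M f" "sq_int M g"
  shows "l2norm M (\<lambda>x. f x + g x) \<le> l2norm M f + l2norm M g"
proof (rule power2_le_imp_le)
  show "(l2norm M (\<lambda>x. f x + g x))\<^sup>2 \<le> (l2norm M f + l2norm M g)\<^sup>2"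
    unfolding l2norm_power2_add[OF assms] using integral_Cauchy_Schwarz[OF assms]
    by (simp add: power2_sum mult.assoc)
qed simp

lemma l2norm_diff_triangle:
  assumes "sq_int M f" "sq_int M g" "sq_int M h"
  shows "l2norm M (\<lambda>x. f x - h x) \<le> l2norm M (\<lambda>x. f x - g x) + l2norm M (\<lambda>x. g x - h x)"
  using l2norm_triangle[OF sq_int_diff[OF assms(1,2)] sq_int_diff[OF assms(2,3)]] by simp

lemma l2norm_minus_commute: "l2norm M (\<lambda>x. f x - g x) = l2norm M (\<lambda>x. g x - f x)"
  by (simp add: l2norm_def power2_commute)

lemma l2norm_triangle_sub:
  assumes "sq_int M f" "sq_int M g"
  shows "\<bar>l2norm M f - l2norm M g\<bar> \<le> l2norm M (\<lambda>x. f x - g x)"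
  using l2norm_diff_triangle[OF assms sq_int_zero] l2norm_diff_triangle[OF assms(2,1) sq_int_zero]
    l2norm_minus_commute[of M f g] by simp

lemma l2norm_tendsto:
  assumes "\<And>n. sq_int M (f n)" "sq_int M g" "(\<lambda>n. l2norm M (\<lambda>x. f n x - g x)) \<longlonglongrightarrow> 0"
  shows "(\<lambda>n. l2norm M (f n)) \<longlonglongrightarrow> l2norm M g"
proof (rule LIM_zero_cancel, rule Lim_null_comparison[OF _ assms(3)])
  show "\<forall>\<^sub>F n in sequentially. norm (l2norm M (f n) - l2norm M g) \<le> l2norm M (\<lambda>x. f n x - g x)"
    using l2norm_triangle_sub[OF assms(1,2)] by simp
qed

lemma integral_mult_tendsto:
  assumes f: "\<And>n. sq_int M (f n)" "sq_int M f'" "(\<lambda>n. l2norm M (\<lambda>x. f n x - f' x)) \<longlonglongrightarrow> 0"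
    and g: "\<And>n. sq_int M (g n)" "sq_int M g'" "(\<lambda>n. l2norm M (\<lambda>x. g n x - g' x)) \<longlonglongrightarrow> 0"
  shows "(\<lambda>n. \<integral>x. f n x * g n x \<partial>M) \<longlonglongrightarrow> (\<integral>x. f' x * g' x \<partial>M)"
proof (rule LIM_zero_cancel, rule Lim_null_comparison)
  show "\<forall>\<^sub>F n in sequentially. norm ((\<integral>x. f n x * g n x \<partial>M) - (\<integral>x. f' x * g' x \<partial>M))
    \<le> l2norm M (\<lambda>x. f n x - f' x) * l2norm M (g n) + l2norm M f' * l2norm M (\<lambda>x. g n x - g' x)"
  proof (intro always_eventually allI)
    fix n
    note df = sq_int_diff[OF f(1,2), of n] and dg = sq_int_diff[OF g(1,2), of n]
    have "(\<integral>x. f n x * g n x \<partial>M) - (\<integral>x. f' x * g' x \<partial>M) = (\<integral>x. f n x * g n x - f' x * g' x \<partial>M)"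
      using sq_int_integrable_mult f g by (intro Bochner_Integration.integral_diff[symmetric]) auto
    also have "\<dots> = (\<integral>x. (f n x - f' x) * g n x + f' x * (g n x - g' x) \<partial>M)"
      by (simp add: algebra_simps)
    also have "\<dots> = (\<integral>x. (f n x - f' x) * g n x \<partial>M) + (\<integral>x. f' x * (g n x - g' x) \<partial>M)"
      using sq_int_integrable_mult f g df dg by (intro Bochner_Integration.integral_add) auto
    finally show "norm ((\<integral>x. f n x * g n x \<partial>M) - (\<integral>x. f' x * g' x \<partial>M))
      \<le> l2norm M (\<lambda>x. f n x - f' x) * l2norm M (g n) + l2norm M f' * l2norm M (\<lambda>x. g n x - g' x)"
      using integral_Cauchy_Schwarz[OF df g(1), of n] integral_Cauchy_Schwarz[OF f(2) dg] by simp
  qed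
  have "(\<lambda>n. l2norm M (\<lambda>x. f n x - f' x) * l2norm M (g n) + l2norm M f' * l2norm M (\<lambda>x. g n x - g' x))
    \<longlonglongrightarrow> 0 * l2norm M g' + l2norm M f' * 0"
    by (intro tendsto_intros f g l2norm_tendsto)
  then show "(\<lambda>n. l2norm M (\<lambda>x. f n x - f' x) * l2norm M (g n) + l2norm M f' * l2norm M (\<lambda>x. g n x - g' x))
    \<longlonglongrightarrow> 0" by simp
qed

lemma l2norm_dominated_convergence:
  assumes f: "\<And>n. f n \<in> borel_measurable M" and g: "g \<in> borel_measurable M"
    and lim: "\<And>x. x \<in> space M \<Longrightarrow> (\<lambda>n. f n x) \<longlonglongrightarrow> g x"
    and w: "sq_int M w" "\<And>n x. x \<in> space M \<Longrightarrow> \<bar>f n x\<bar> \<le> w x"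
  shows "sq_int M g" "(\<lambda>n. l2norm M (\<lambda>x. g x - f n x)) \<longlonglongrightarrow> 0"
proof -
  have b: "\<bar>g x\<bar> \<le> w x" if "x \<in> space M" for x
    using tendsto_rabs[OF lim[OF that]] w(2)[OF that]
    by (intro LIMSEQ_le_const2) auto
  show "sq_int M g"
    by (rule sq_int_bound[OF w(1) g]) (use b in \<open>auto intro!: AE_I2 order_trans[OF _ abs_ge_self]\<close>)
  have "(\<lambda>n. \<integral>x. (g x - f n x)\<^sup>2 \<partial>M) \<longlonglongrightarrow> (\<integral>x. 0 \<partial>M)"
  \<comment> \<open>Both \<open>g\<close> and \<open>f n\<close> are bounded by \<open>w\<close>, so
    their difference is bounded by \<open>2 * w\<close>; squaring gives the constant 4.\<close>
  proof (rule integral_dominated_convergence[where w = "\<lambda>x. 4 * (w x)\<^sup>2"])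
    show "integrable M (\<lambda>x. 4 * (w x)\<^sup>2)" using w(1) by (simp add: sq_int_def)
    show "AE x in M. (\<lambda>n. (g x - f n x)\<^sup>2) \<longlonglongrightarrow> 0"
    proof (rule AE_I2)
      fix x assume "x \<in> space M"
      from tendsto_diff[OF tendsto_const[of "g x"] lim[OF this]]
      show "(\<lambda>n. (g x - f n x)\<^sup>2) \<longlonglongrightarrow> 0" by (intro tendsto_null_power) simp_all
    qed
    show "AE x in M. norm ((g x - f n x)\<^sup>2) \<le> 4 * (w x)\<^sup>2" for n
    proof (rule AE_I2)
      fix x assume x: "x \<in> space M"
      have "\<bar>g x - f n x\<bar> \<le> 2 * w x" using b[OF x] w(2)[OF x, of n] by linarith
      then have "\<bar>g x - f n x\<bar>\<^sup>2 \<le> (2 * w x)\<^sup>2" by (intro power_mono) auto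
      then show "norm ((g x - f n x)\<^sup>2) \<le> 4 * (w x)\<^sup>2" by (simp add: power_mult_distrib)
    qed
  qed (use f g in auto)
  then show "(\<lambda>n. l2norm M (\<lambda>x. g x - f n x)) \<longlonglongrightarrow> 0"
    unfolding l2norm_def using tendsto_real_sqrt by fastforce
qed

section \<open>Mean-square closure of a linear space of functions\<close>

locale l2_subspace = prob_space M for M :: "'a measure" +
  fixes S :: "('a \<Rightarrow> real) set"
  assumes S_sq_int: "\<And>f. f \<in> S \<Longrightarrow> sq_int M f"
    and S_add: "\<And>f g. f \<in> S \<Longrightarrow> g \<in> S \<Longrightarrow> (\<lambda>x. f x + g x) \<in> S"
    and S_cmult: "\<And>f c. f \<in> S \<Longrightarrow> (\<lambda>x. c * f x) \<in> S"
    and S_nonempty: "S \<noteq> {}"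
begin

definition l2_closure :: "('a \<Rightarrow> real) set"
  where "l2_closure = {f. sq_int M f \<and> (\<forall>e>0. \<exists>g\<in>S. l2norm M (\<lambda>x. f x - g x) < e)}"

lemma closure_sq_int: "f \<in> l2_closure \<Longrightarrow> sq_int M f"
  by (simp add: l2_closure_def)

lemma closure_approx: "f \<in> l2_closure \<Longrightarrow> 0 < e \<Longrightarrow> \<exists>g\<in>S. l2norm M (\<lambda>x. f x - g x) < e"
  by (simp add: l2_closure_def)

lemma closure_cong:
  assumes "f \<in> l2_closure" "\<And>x. x \<in> space M \<Longrightarrow> f x = g x"
  shows "g \<in> l2_closure"
proof -
  have "sq_int M g \<longleftrightarrow> sq_int M f"
    unfolding sq_int_def using assms(2)
    by (simp cong: measurable_cong Bochner_Integration.integrable_cong)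
  moreover have "l2norm M (\<lambda>x. g x - h x) = l2norm M (\<lambda>x. f x - h x)" for h
    unfolding l2norm_def using assms(2) by (simp cong: Bochner_Integration.integral_cong)
  ultimately show ?thesis using assms(1) by (simp add: l2_closure_def)
qed

lemma subset_closure: "f \<in> S \<Longrightarrow> f \<in> l2_closure"
  by (auto simp: l2_closure_def S_sq_int l2norm_def intro!: bexI[of _ f])

lemma zero_closure: "(\<lambda>x. 0) \<in> l2_closure"
proof -
  obtain f where "f \<in> S" using S_nonempty by blast
  from S_cmult[OF this, of 0] show ?thesis by (intro subset_closure) simp
qed

lemma closure_lim:
  assumes f: "\<And>n. f n \<in> l2_closure" "sq_int M g" "(\<lambda>n. l2norm M (\<lambda>x. g x - f n x)) \<longlonglongrightarrow> 0"
  shows "g \<in> l2_closure"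
  unfolding l2_closure_def
proof safe
  fix e :: real assume e: "0 < e"
  then obtain n where n: "l2norm M (\<lambda>x. g x - f n x) < e / 2"
    using order_tendstoD(2)[OF f(3), of "e/2"] by (auto simp: eventually_sequentially)
  obtain h where h: "h \<in> S" "l2norm M (\<lambda>x. f n x - h x) < e / 2"
    using closure_approx[OF f(1) half_gt_zero[OF e]] by blast
  have "l2norm M (\<lambda>x. g x - h x) < e"
    using l2norm_diff_triangle[OF f(2) closure_sq_int[OF f(1)] S_sq_int[OF h(1)], of n] n h(2) by simp
  with h(1) show "\<exists>h\<in>S. l2norm M (\<lambda>x. g x - h x) < e" by blast
qed (rule f(2))

lemma closure_add:
  assumes f: "f \<in> l2_closure" and g: "g \<in> l2_closure"
  shows "(\<lambda>x. f x + g x) \<in> l2_closure"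
  unfolding l2_closure_def
proof safe
  show "sq_int M (\<lambda>x. f x + g x)" using f g by (intro sq_int_add closure_sq_int)
  fix e :: real assume e: "0 < e"
  obtain f' where f': "f' \<in> S" "l2norm M (\<lambda>x. f x - f' x) < e / 2"
    using closure_approx[OF f half_gt_zero[OF e]] by blast
  obtain g' where g': "g' \<in> S" "l2norm M (\<lambda>x. g x - g' x) < e / 2"
    using closure_approx[OF g half_gt_zero[OF e]] by blast
  have "l2norm M (\<lambda>x. (f x - f' x) + (g x - g' x)) < e"
    using l2norm_triangle[OF sq_int_diff[OF closure_sq_int[OF f] S_sq_int[OF f'(1)]]
        sq_int_diff[OF closure_sq_int[OF g] S_sq_int[OF g'(1)]]] f'(2) g'(2) by simp
  then have "l2norm M (\<lambda>x. f x + g x - (f' x + g' x)) < e" by (simp add: algebra_simps)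
  with S_add[OF f'(1) g'(1)] show "\<exists>h\<in>S. l2norm M (\<lambda>x. f x + g x - h x) < e"
    by (intro bexI[of _ "\<lambda>x. f' x + g' x"])
qed

lemma closure_cmult:
  assumes f: "f \<in> l2_closure"
  shows "(\<lambda>x. c * f x) \<in> l2_closure"
proof (cases "c = 0")
  case False
  show ?thesis
    unfolding l2_closure_def
  proof safe
    show "sq_int M (\<lambda>x. c * f x)" using f by (intro sq_int_cmult closure_sq_int)
    fix e :: real assume e: "0 < e"
    then have "0 < e / \<bar>c\<bar>" using False by simp
    with f obtain g where g: "g \<in> S" "l2norm M (\<lambda>x. f x - g x) < e / \<bar>c\<bar>"
      unfolding l2_closure_def by blast
    have "l2norm M (\<lambda>x. c * f x - c * g x) = \<bar>c\<bar> * l2norm M (\<lambda>x. f x - g x)"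
      by (simp add: l2norm_cmult[symmetric] algebra_simps)
    also have "\<dots> < e" using g(2) False by (simp add: field_simps)
    finally show "\<exists>h\<in>S. l2norm M (\<lambda>x. c * f x - h x) < e" using S_cmult[OF g(1), of c]
      by (intro bexI[of _ "\<lambda>x. c * g x"])
  qed
qed (simp add: zero_closure)

lemma closure_sum:
  assumes "\<And>i. i \<in> I \<Longrightarrow> f i \<in> l2_closure"
  shows "(\<lambda>x. \<Sum>i\<in>I. f i x) \<in> l2_closure"
  using assms by (induction I rule: infinite_finite_induct) (auto intro: closure_add zero_closure)

text \<open>Dynkin's pi-lambda theorem. Complements are formed by subtracting from the indicator of
  \<open>space M\<close>; a countable disjoint union is the limit of its partial sums, which are
  dominated by the constant 1.\<close>

lemma indicator_closure:
  assumes E: "Int_stable E" "E \<subseteq> sets M" "space M \<in> E"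
    and ind: "\<And>X. X \<in> E \<Longrightarrow> indicator X \<in> S"
    and D: "D \<in> sigma_sets (space M) E"
  shows "indicator D \<in> l2_closure"
proof -
  have "E \<subseteq> Pow (space M)" using E(2) sets.sets_into_space by blast
  from E(1) this D have "D \<in> sets M \<and> indicator D \<in> l2_closure"
  proof (induction rule: sigma_sets_induct_disjoint)
    case (basic X)
    then show ?case using E ind subset_closure by auto
  next
    case empty
    have "indicator {} = (\<lambda>x::'a. 0::real)" by (auto simp: indicator_def)
    then show ?case using zero_closure by simp
  next
    case (compl X)
    have "(\<lambda>x. indicator (space M) x + (-1) * indicator X x :: real) \<in> l2_closure"
      using compl(2) by (intro closure_add closure_cmult subset_closure[OF ind[OF E(3)]]) auto
    moreover have "(\<lambda>x. indicator (space M) x + (-1) * indicator X x :: real) = indicator (space M - X)"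
      using sets.sets_into_space[of X M] compl by (auto simp: indicator_def fun_eq_iff)
    ultimately show ?case using compl by auto
  next
    case (union X)
    have XM: "X i \<in> sets M" for i using union by auto
    let ?f = "\<lambda>n x. \<Sum>i<n. indicator (X i) x :: real"
    have f: "?f n x = indicator (\<Union>i<n. X i) x" for n x
      using union(1) by (intro indicator_UN_disjoint[symmetric] disjoint_family_on_mono[OF _ union(1)]) auto
    have lim: "(\<lambda>n. ?f n x) \<longlonglongrightarrow> indicator (\<Union>i. X i) x" for x
      unfolding f by (rule LIMSEQ_indicator_UN)
    have 1: "sq_int M (\<lambda>x. 1)" by (simp add: sq_int_def)
    have m: "?f n \<in> borel_measurable M" "indicator (\<Union>i. X i) \<in> borel_measurable M" for n
      using XM by (auto intro!: borel_measurable_sum)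
    have le: "\<bar>?f n x\<bar> \<le> 1" for n x
      unfolding f by (simp add: indicator_def)
    note * = l2norm_dominated_convergence[OF m lim 1 le]
    have "indicator (\<Union>i. X i) \<in> l2_closure"
      using union by (intro closure_lim[OF _ *] closure_sum) auto
    then show ?case using XM by auto
  qed
  then show ?thesis by blast
qed

lemma sq_int_closure:
  assumes E: "Int_stable E" "E \<subseteq> sets M" "space M \<in> E"
    and ind: "\<And>X. X \<in> E \<Longrightarrow> indicator X \<in> S"
    and A: "subalgebra M A" "sets A \<subseteq> sigma_sets (space M) E"
    and f: "sq_int M f" "f \<in> borel_measurable A"
  shows "f \<in> l2_closure"
proof -
  have sp: "space A = space M" using A(1) by (simp add: subalgebra_def)
  \<comment> \<open>The reference point 0 yields simple functions bounded by twice the absolute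
    value of \<open>f\<close>, which is a square-integrable dominating function.\<close>
  from borel_measurable_implies_sequence_metric[OF f(2), of 0] obtain s
    where s: "\<And>i. simple_function A (s i)"
      and lim: "\<And>x. x \<in> space M \<Longrightarrow> (\<lambda>i. s i x) \<longlonglongrightarrow> f x"
      and bound: "\<And>i x. x \<in> space M \<Longrightarrow> \<bar>s i x\<bar> \<le> 2 * \<bar>f x\<bar>"
    unfolding sp dist_real_def by simp blast
  have cl: "s i \<in> l2_closure" for i
  proof -
    have "(\<lambda>x. \<Sum>y\<in>s i ` space M. y * indicator (s i -` {y} \<inter> space M) x) \<in> l2_closure"
    proof (intro closure_sum closure_cmult indicator_closure[OF E ind])
      fix y
      have "s i -` {y} \<inter> space M \<in> sets A" using simple_functionD(2)[OF s[of i], of "{y}"] by (simp add: sp)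
      then show "s i -` {y} \<inter> space M \<in> sigma_sets (space M) E" using A(2) by blast
    qed
    then show ?thesis
    proof (rule closure_cong)
      fix x assume x: "x \<in> space M"
      have fin: "finite (s i ` space M)" using simple_functionD(1)[OF s[of i]] by (simp add: sp)
      have "(\<Sum>y\<in>s i ` space M. y * indicator (s i -` {y} \<inter> space M) x)
          = (\<Sum>y\<in>s i ` space M. if y = s i x then y else 0)"
        using x by (intro sum.cong) (auto simp: indicator_def)
      then show "(\<Sum>y\<in>s i ` space M. y * indicator (s i -` {y} \<inter> space M) x) = s i x"
        using x fin by simp
    qed
  qed
  have w: "sq_int M (\<lambda>x. 2 * \<bar>f x\<bar>)"
    using f(1) by (intro sq_int_cmult) (auto simp: sq_int_def)
  show ?thesis
    by (rule closure_lim[OF cl f(1) l2norm_dominated_convergence(2)[OF _ _ lim w bound]])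
       (use f(1) closure_sq_int[OF cl] in auto)
qed

lemma closureE:
  assumes "f \<in> l2_closure"
  obtains g where "\<And>n. g n \<in> S" "(\<lambda>n. l2norm M (\<lambda>x. g n x - f x)) \<longlonglongrightarrow> 0"
proof -
  have "\<exists>g\<in>S. l2norm M (\<lambda>x. f x - g x) < inverse (real (Suc n))" for n
    using assms by (simp add: l2_closure_def)
  then obtain g where g: "\<And>n. g n \<in> S" "\<And>n. l2norm M (\<lambda>x. f x - g n x) < inverse (real (Suc n))"
    by metis
  have "(\<lambda>n. l2norm M (\<lambda>x. g n x - f x)) \<longlonglongrightarrow> 0"
    by (rule Lim_null_comparison[OF _ LIMSEQ_inverse_real_of_nat])
       (use g(2) in \<open>auto intro!: always_eventually less_imp_le simp: l2norm_minus_commute[of M _ f]\<close>)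
  with g(1) show thesis by (rule that)
qed

end

section \<open>Joins of two conditionally independent blocks\<close>

text \<open>Only the second factor is an indicator. The first one ranges over all square-integrable
  functions, a class that is closed under subtracting the conditional expectation given
  \<open>F\<close>.\<close>

definition rect_sums :: "'a measure \<Rightarrow> 'a measure \<Rightarrow> 'a measure \<Rightarrow> ('a \<Rightarrow> real) set"
  where "rect_sums M A1 A2 = {\<lambda>x. \<Sum>k<m. a k x * indicator (C k) x | a C (m :: nat).
    \<forall>k<m. sq_int M (a k) \<and> a k \<in> borel_measurable A1 \<and> C k \<in> sets A2}"

lemma rect_sumsI:
  fixes a :: "nat \<Rightarrow> 'a \<Rightarrow> real"
  assumes "\<And>k. k < m \<Longrightarrow> sq_int M (a k)" "\<And>k. k < m \<Longrightarrow> a k \<in> borel_measurable A1"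
    "\<And>k. k < m \<Longrightarrow> C k \<in> sets A2"
  shows "(\<lambda>x. \<Sum>k<m. a k x * indicator (C k) x) \<in> rect_sums M A1 A2"
  unfolding rect_sums_def using assms by blast

lemma rect_sumsE:
  assumes "g \<in> rect_sums M A1 A2"
  obtains a C and m :: nat where "g = (\<lambda>x. \<Sum>k<m. a k x * indicator (C k) x)"
    "\<And>k. k < m \<Longrightarrow> sq_int M (a k)" "\<And>k. k < m \<Longrightarrow> a k \<in> borel_measurable A1"
    "\<And>k. k < m \<Longrightarrow> C k \<in> sets A2"
  using assms unfolding rect_sums_def by blast

context prob_space
begin

lemma indicator_Int_rect_sums:
  assumes A: "subalgebra M A1" and "E \<in> sets A1" "C \<in> sets A2"
  shows "indicator (E \<inter> C) \<in> rect_sums M A1 A2"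
proof -
  have "E \<in> sets M" using assms by (auto simp: subalgebra_def)
  then have "(\<lambda>x. \<Sum>k<1::nat. indicator E x * indicator C x) \<in> rect_sums M A1 A2"
    using assms by (intro rect_sumsI[where a = "\<lambda>_. indicator E" and C = "\<lambda>_. C"] sq_int_indicator) auto
  moreover have "(\<lambda>x. \<Sum>k<1::nat. indicator E x * indicator C x :: real) = indicator (E \<inter> C)"
    by (auto simp: indicator_def fun_eq_iff)
  ultimately show ?thesis by metis
qed

lemma l2_subspace_rect_sums:
  assumes A: "subalgebra M A1" "subalgebra M A2"
  shows "l2_subspace M (rect_sums M A1 A2)"
proof
  have sub: "C \<in> sets A2 \<Longrightarrow> C \<in> sets M" for C using A by (auto simp: subalgebra_def)
  show "sq_int M f" if "f \<in> rect_sums M A1 A2" for f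
    using that by (elim rect_sumsE) (simp only:, intro sq_int_sum sq_int_mult_indicator sub, auto)
  show "(\<lambda>x. c * f x) \<in> rect_sums M A1 A2" if f: "f \<in> rect_sums M A1 A2" for f c
  proof -
    from f obtain a C and m :: nat where *: "f = (\<lambda>x. \<Sum>k<m. a k x * indicator (C k) x)"
      "\<And>k. k < m \<Longrightarrow> sq_int M (a k)" "\<And>k. k < m \<Longrightarrow> a k \<in> borel_measurable A1"
      "\<And>k. k < m \<Longrightarrow> C k \<in> sets A2" by (rule rect_sumsE) blast
    have "(\<lambda>x. \<Sum>k<m. (c * a k x) * indicator (C k) x) \<in> rect_sums M A1 A2"
      using * by (intro rect_sumsI sq_int_cmult) auto
    then show ?thesis unfolding *(1) sum_distrib_left by (simp only: mult.assoc)
  qed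
  show "(\<lambda>x. f x + g x) \<in> rect_sums M A1 A2"
    if f: "f \<in> rect_sums M A1 A2" and g: "g \<in> rect_sums M A1 A2" for f g
  proof -
    from f obtain a C and m :: nat where 1: "f = (\<lambda>x. \<Sum>k<m. a k x * indicator (C k) x)"
      "\<And>k. k < m \<Longrightarrow> sq_int M (a k)" "\<And>k. k < m \<Longrightarrow> a k \<in> borel_measurable A1"
      "\<And>k. k < m \<Longrightarrow> C k \<in> sets A2" by (rule rect_sumsE) blast
    from g obtain b D and n :: nat where 2: "g = (\<lambda>x. \<Sum>k<n. b k x * indicator (D k) x)"
      "\<And>k. k < n \<Longrightarrow> sq_int M (b k)" "\<And>k. k < n \<Longrightarrow> b k \<in> borel_measurable A1"
      "\<And>k. k < n \<Longrightarrow> D k \<in> sets A2" by (rule rect_sumsE) blast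
    define a' where "a' = (\<lambda>k. if k < m then a k else b (k - m))"
    define C' where "C' = (\<lambda>k. if k < m then C k else D (k - m))"
    have "(\<lambda>x. \<Sum>k<m + n. a' k x * indicator (C' k) x) \<in> rect_sums M A1 A2"
      using 1 2 by (intro rect_sumsI) (auto simp: a'_def C'_def)
    moreover have "(\<Sum>k<m + n. a' k x * indicator (C' k) x) = f x + g x" for x
    proof -
      have "(\<Sum>k<m + j. a' k x * indicator (C' k) x)
          = (\<Sum>k<m. a k x * indicator (C k) x) + (\<Sum>k<j. b k x * indicator (D k) x)" for j
        by (induction j) (auto simp: a'_def C'_def)
      then show ?thesis by (simp add: 1(1) 2(1))
    qed
    ultimately show ?thesis by simp
  qed
  have "(\<lambda>x. \<Sum>k<0::nat. 0 * indicator {} x) \<in> rect_sums M A1 A2"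
    using rect_sumsI[of 0 M "\<lambda>_ _. 0" A1 "\<lambda>_. {}" A2] by simp
  then show "rect_sums M A1 A2 \<noteq> {}" by blast
qed

text \<open>The intersections \<open>E \<inter> C\<close> form a pi-system, and their indicators are
  sums with a single term.\<close>

lemma sq_int_closure_rect_sums:
  assumes A: "subalgebra M A1" "subalgebra M A2" "subalgebra M A"
    and gen: "sets A \<subseteq> sigma_sets (space M) {E \<inter> C | E C. E \<in> sets A1 \<and> C \<in> sets A2}"
    and f: "sq_int M f" "f \<in> borel_measurable A"
  shows "f \<in> l2_subspace.l2_closure M (rect_sums M A1 A2)"
proof (rule l2_subspace.sq_int_closure[OF l2_subspace_rect_sums[OF A(1,2)] _ _ _ _ A(3) gen f])
  let ?E = "{E \<inter> C | E C. E \<in> sets A1 \<and> C \<in> sets A2}"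
  show "Int_stable ?E"
  proof (rule Int_stableI)
    fix X Y assume "X \<in> ?E" "Y \<in> ?E"
    then obtain E C E' C' where "X = E \<inter> C" "Y = E' \<inter> C'" "E \<in> sets A1" "C \<in> sets A2"
      "E' \<in> sets A1" "C' \<in> sets A2" by blast
    then show "X \<inter> Y \<in> ?E"
      by (intro CollectI exI[of _ "E \<inter> E'"] exI[of _ "C \<inter> C'"]) auto
  qed
  show "?E \<subseteq> sets M" using A by (auto simp: subalgebra_def)
  show "space M \<in> ?E"
    using A sets.top[of A1] sets.top[of A2]
    by (intro CollectI exI[of _ "space M"]) (auto simp: subalgebra_def)
  show "indicator X \<in> rect_sums M A1 A2" if "X \<in> ?E" for X
    using that indicator_Int_rect_sums[OF A(1)] by auto
qed

end

text \<open>Replacing each coefficient by its conditional expectation gives \<open>g2\<close>, which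
  belongs to the second block because \<open>F\<close> is contained in \<open>A2\<close>; the
  remainder \<open>g1\<close> is orthogonal to all of \<open>G2\<close>. The function
  \<open>u\<close> is the centering of \<open>g2\<close>. The norm relation is only an inequality
  since this last centering can decrease the norm.\<close>

lemma (in cond_indep_algebras) rect_sums_decomp:
  assumes sub: "subalgebra G1 A1" "subalgebra G2 A2" "subalgebra A1 F" "subalgebra A2 F"
    and g: "g \<in> rect_sums M A1 A2"
  obtains a C and m :: nat and u where
    "\<And>k. k < m \<Longrightarrow> sq_int M (a k)" "\<And>k. k < m \<Longrightarrow> a k \<in> borel_measurable A1"
    "\<And>k. k < m \<Longrightarrow> AE x in M. real_cond_exp M F (a k) x = 0"
    "\<And>k. k < m \<Longrightarrow> C k \<in> sets A2"
    "sq_int M (\<lambda>x. \<Sum>k<m. a k x * indicator (C k) x)"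
    "\<And>v. sq_int M v \<Longrightarrow> v \<in> borel_measurable G2 \<Longrightarrow>
      (\<integral>x. (\<Sum>k<m. a k x * indicator (C k) x) * v x \<partial>M) = 0"
    "sq_int M u" "u \<in> borel_measurable A2" "AE x in M. real_cond_exp M F u x = 0"
    "AE x in M. g x - real_cond_exp M F g x = (\<Sum>k<m. a k x * indicator (C k) x) + u x"
    "(l2norm M (\<lambda>x. \<Sum>k<m. a k x * indicator (C k) x))\<^sup>2 + (l2norm M u)\<^sup>2 \<le> (l2norm M g)\<^sup>2"
proof -
  from g obtain b C and m :: nat where geq: "g = (\<lambda>x. \<Sum>k<m. b k x * indicator (C k) x)"
    and b: "\<And>k. k < m \<Longrightarrow> sq_int M (b k)" "\<And>k. k < m \<Longrightarrow> b k \<in> borel_measurable A1"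
    and C: "\<And>k. k < m \<Longrightarrow> C k \<in> sets A2" by (rule rect_sumsE) blast
  define e where "e k = real_cond_exp M F (b k)" for k
  define a where "a k = (\<lambda>x. b k x - e k x)" for k
  define g1 where "g1 = (\<lambda>x. \<Sum>k<m. a k x * indicator (C k) x)"
  define g2 where "g2 = (\<lambda>x. \<Sum>k<m. e k x * indicator (C k) x)"
  define u where "u = (\<lambda>x. g2 x - real_cond_exp M F g2 x)"
  have CG: "C k \<in> sets G2" and CM: "C k \<in> sets M" if "k < m" for k
    using C[OF that] sub subalgebras by (auto simp: subalgebra_def)
  have e: "sq_int M (e k)" if "k < m" for k
    unfolding e_def by (intro real_cond_exp_sq_int subalgebras b that)
  have a: "sq_int M (a k)" if "k < m" for k
    unfolding a_def by (intro sq_int_diff b e that)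
  have eF: "e k \<in> borel_measurable F" for k by (simp add: e_def)
  have aA: "a k \<in> borel_measurable A1" if "k < m" for k
    unfolding a_def using b(2)[OF that] measurable_from_subalg[OF sub(3) eF] by auto
  have a0: "AE x in M. real_cond_exp M F (a k) x = 0" if "k < m" for k
    unfolding a_def e_def by (intro real_cond_exp_centered subalgebras sq_int_imp_integrable b that)
  have aC: "sq_int M (\<lambda>x. a k x * indicator (C k) x)" if "k < m" for k
    using a CM that by (intro sq_int_mult_indicator)
  have g1: "sq_int M g1" unfolding g1_def by (intro sq_int_sum aC) simp
  have g2: "sq_int M g2" unfolding g2_def by (intro sq_int_sum sq_int_mult_indicator e CM) simp_all
  have g2A: "g2 \<in> borel_measurable A2"
    unfolding g2_def using measurable_from_subalg[OF sub(4) eF] C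
    by (intro borel_measurable_sum borel_measurable_times borel_measurable_indicator) auto
  have u: "sq_int M u" unfolding u_def by (intro sq_int_diff real_cond_exp_sq_int g2 subalgebras)
  have uA: "u \<in> borel_measurable A2"
    unfolding u_def using g2A measurable_from_subalg[OF sub(4) borel_measurable_cond_exp] by auto
  have u0: "AE x in M. real_cond_exp M F u x = 0"
    unfolding u_def by (intro real_cond_exp_centered sq_int_imp_integrable g2 subalgebras)
  have aC_orth: "(\<integral>x. a k x * indicator (C k) x * v x \<partial>M) = 0"
    if k: "k < m" and v: "sq_int M v" "v \<in> borel_measurable G2" for k v
  proof -
    have "(\<integral>x. a k x * (v x * indicator (C k) x) \<partial>M) = 0"
      using v CG[OF k] CM[OF k]
      by (intro integral_mult_eq_0 a a0 k measurable_from_subalg[OF sub(1) aA] sq_int_mult_indicator) auto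
    then show ?thesis by (simp add: mult_ac)
  qed
  have orth: "(\<integral>x. g1 x * v x \<partial>M) = 0" if v: "sq_int M v" "v \<in> borel_measurable G2" for v
  proof -
    have "(\<integral>x. g1 x * v x \<partial>M) = (\<Sum>k<m. \<integral>x. a k x * indicator (C k) x * v x \<partial>M)"
      unfolding g1_def sum_distrib_right using aC v(1)
      by (intro Bochner_Integration.integral_sum sq_int_integrable_mult) auto
    then show ?thesis using aC_orth v by simp
  qed
  have geq12: "g = (\<lambda>x. g1 x + g2 x)"
    unfolding geq g1_def g2_def a_def sum.distrib[symmetric]
    by (intro ext sum.cong) (auto simp: left_diff_distrib)
  \<comment> \<open>Orthogonality to the indicators of the sets in \<open>F\<close>, which all lie
    in \<open>G2\<close>, already determines the conditional expectation.\<close>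
  have "AE x in M. real_cond_exp M F g1 x = 0"
  proof (rule F.real_cond_exp_charact)
    fix H assume H: "H \<in> sets F"
    then have HG: "H \<in> sets G2" and HM: "H \<in> sets M"
      using subalgebras by (auto simp: subalgebra_def)
    have "(\<integral>x. g1 x * indicator H x \<partial>M) = 0"
      using HG by (intro orth sq_int_indicator HM) auto
    then show "(\<integral>x\<in>H. g1 x \<partial>M) = (\<integral>x\<in>H. 0 \<partial>M)"
      by (simp add: set_lebesgue_integral_def mult.commute)
  qed (use g1 in \<open>auto intro: sq_int_imp_integrable\<close>)
  with F.real_cond_exp_add[OF sq_int_imp_integrable[OF g1] sq_int_imp_integrable[OF g2]]
  have g_eq: "AE x in M. g x - real_cond_exp M F g x = g1 x + u x"
    unfolding geq12 by eventually_elim (simp add: u_def)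
  have "g2 \<in> borel_measurable G2" by (rule measurable_from_subalg[OF sub(2) g2A])
  from l2norm_power2_add[OF g1 g2] orth[OF g2 this]
  have "(l2norm M g1)\<^sup>2 + (l2norm M g2)\<^sup>2 = (l2norm M g)\<^sup>2"
    unfolding geq12 by simp
  moreover have "(l2norm M u)\<^sup>2 \<le> (l2norm M g2)\<^sup>2"
    unfolding u_def by (intro power_mono l2norm_centered_le subalgebras g2) simp
  ultimately have "(l2norm M g1)\<^sup>2 + (l2norm M u)\<^sup>2 \<le> (l2norm M g)\<^sup>2" by linarith
  from that[OF a aA a0 C g1[unfolded g1_def] orth[unfolded g1_def] u uA u0 g_eq[unfolded g1_def]
      this[unfolded g1_def]]
  show thesis .
qed

lemma Cauchy_Schwarz_real2:
  fixes a b c d x y :: real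
  assumes "a\<^sup>2 + b\<^sup>2 \<le> x\<^sup>2" "c\<^sup>2 + d\<^sup>2 \<le> y\<^sup>2" "0 \<le> x" "0 \<le> y"
  shows "a * c + b * d \<le> x * y"
proof (rule power2_le_imp_le)
  \<comment> \<open>Lagrange's identity: the two sides differ by the square of
    \<open>a * d - b * c\<close>.\<close>
  have "(a * c + b * d)\<^sup>2 \<le> (a\<^sup>2 + b\<^sup>2) * (c\<^sup>2 + d\<^sup>2)"
    using zero_le_power2[of "a * d - b * c"] by (simp add: power2_eq_square algebra_simps)
  also have "\<dots> \<le> x\<^sup>2 * y\<^sup>2" using assms by (intro mult_mono) auto
  finally show "(a * c + b * d)\<^sup>2 \<le> (x * y)\<^sup>2" by (simp add: power_mult_distrib)
qed (use assms in auto)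

context cond_indep_algebras
begin

text \<open>Of the four products of the parts, the two mixed ones integrate to 0, because
  \<open>u\<close> and \<open>v\<close> are \<open>G2\<close>-measurable. The other two are
  controlled by the bounds of the two blocks, and \<open>Cauchy_Schwarz_real2\<close> recombines the
  norms.\<close>

lemma mc_bound_rect_sums:
  assumes A: "subalgebra G1 A1" "subalgebra G2 A2" "subalgebra A1 F" "subalgebra A2 F"
    and B: "subalgebra G1 B1" "subalgebra G2 B2" "subalgebra B1 F" "subalgebra B2 F"
    and mc1: "mc_bound M F A1 B1 r" and mc2: "mc_bound M F A2 B2 r" and r: "0 \<le> r"
    and g: "g \<in> rect_sums M A1 A2" and h: "h \<in> rect_sums M B1 B2"
  shows "(\<integral>x. (g x - real_cond_exp M F g x) * (h x - real_cond_exp M F h x) \<partial>M)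
    \<le> r * (l2norm M g * l2norm M h)"
proof -
  obtain a C and m :: nat and u where
    a: "\<And>k. k < m \<Longrightarrow> sq_int M (a k)" "\<And>k. k < m \<Longrightarrow> a k \<in> borel_measurable A1"
    "\<And>k. k < m \<Longrightarrow> AE x in M. real_cond_exp M F (a k) x = 0"
    and C: "\<And>k. k < m \<Longrightarrow> C k \<in> sets A2"
    and g1: "sq_int M (\<lambda>x. \<Sum>k<m. a k x * indicator (C k) x)"
    "\<And>v. sq_int M v \<Longrightarrow> v \<in> borel_measurable G2 \<Longrightarrow>
      (\<integral>x. (\<Sum>k<m. a k x * indicator (C k) x) * v x \<partial>M) = 0"
    and u: "sq_int M u" "u \<in> borel_measurable A2" "AE x in M. real_cond_exp M F u x = 0"
    and geq: "AE x in M. g x - real_cond_exp M F g x = (\<Sum>k<m. a k x * indicator (C k) x) + u x"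
    and gn: "(l2norm M (\<lambda>x. \<Sum>k<m. a k x * indicator (C k) x))\<^sup>2 + (l2norm M u)\<^sup>2 \<le> (l2norm M g)\<^sup>2"
    by (rule rect_sums_decomp[OF A g]) (rule that; assumption)
  obtain b D and n :: nat and v where
    b: "\<And>k. k < n \<Longrightarrow> sq_int M (b k)" "\<And>k. k < n \<Longrightarrow> b k \<in> borel_measurable B1"
    "\<And>k. k < n \<Longrightarrow> AE x in M. real_cond_exp M F (b k) x = 0"
    and D: "\<And>k. k < n \<Longrightarrow> D k \<in> sets B2"
    and h1: "sq_int M (\<lambda>x. \<Sum>k<n. b k x * indicator (D k) x)"
    "\<And>w. sq_int M w \<Longrightarrow> w \<in> borel_measurable G2 \<Longrightarrow>
      (\<integral>x. (\<Sum>k<n. b k x * indicator (D k) x) * w x \<partial>M) = 0"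
    and v: "sq_int M v" "v \<in> borel_measurable B2" "AE x in M. real_cond_exp M F v x = 0"
    and heq: "AE x in M. h x - real_cond_exp M F h x = (\<Sum>k<n. b k x * indicator (D k) x) + v x"
    and hn: "(l2norm M (\<lambda>x. \<Sum>k<n. b k x * indicator (D k) x))\<^sup>2 + (l2norm M v)\<^sup>2 \<le> (l2norm M h)\<^sup>2"
    by (rule rect_sums_decomp[OF B h]) (rule that; assumption)
  define g1' where "g1' = (\<lambda>x. \<Sum>k<m. a k x * indicator (C k) x)"
  define h1' where "h1' = (\<lambda>x. \<Sum>k<n. b k x * indicator (D k) x)"
  have g1'_eq: "(\<Sum>k<m. a k x * indicator (C k) x) = g1' x"
    and h1'_eq: "(\<Sum>k<n. b k x * indicator (D k) x) = h1' x" for x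
    by (simp_all only: g1'_def h1'_def)
  note g1 = g1[unfolded g1'_eq] and geq = geq[unfolded g1'_eq] and gn = gn[unfolded g1'_eq]
  note h1 = h1[unfolded h1'_eq] and heq = heq[unfolded h1'_eq] and hn = hn[unfolded h1'_eq]
  have "subalgebra M A1" "subalgebra M B1" "subalgebra M A2" "subalgebra M B2"
    using A B subalgebras by (auto simp: subalgebra_def)
  then have gM: "g \<in> borel_measurable M" and hM: "h \<in> borel_measurable M"
    using l2_subspace.S_sq_int[OF l2_subspace_rect_sums g] l2_subspace.S_sq_int[OF l2_subspace_rect_sums h]
    by auto
  have CG: "C k \<in> sets G2" if "k < m" for k using C[OF that] A by (auto simp: subalgebra_def)
  have DG: "D k \<in> sets G2" if "k < n" for k using D[OF that] B by (auto simp: subalgebra_def)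
  have uG: "u \<in> borel_measurable G2" and vG: "v \<in> borel_measurable G2"
    by (rule measurable_from_subalg[OF A(2) u(2)], rule measurable_from_subalg[OF B(2) v(2)])
  have "(\<integral>x. (g x - real_cond_exp M F g x) * (h x - real_cond_exp M F h x) \<partial>M)
      = (\<integral>x. (g1' x + u x) * (h1' x + v x) \<partial>M)"
  proof (rule integral_cong_AE)
    show "AE x in M. (g x - real_cond_exp M F g x) * (h x - real_cond_exp M F h x)
        = (g1' x + u x) * (h1' x + v x)"
      using geq heq by eventually_elim simp
  qed (use gM hM g1(1) h1(1) u(1) v(1) in measurable)
  also have "\<dots> = (\<integral>x. g1' x * h1' x + u x * v x + g1' x * v x + h1' x * u x \<partial>M)"
    by (simp add: algebra_simps)
  also have "\<dots> = (\<integral>x. g1' x * h1' x \<partial>M) + (\<integral>x. u x * v x \<partial>M)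
      + (\<integral>x. g1' x * v x \<partial>M) + (\<integral>x. h1' x * u x \<partial>M)"
    using g1(1) h1(1) u(1) v(1) by (simp add: sq_int_integrable_mult)
  also have "\<dots> = (\<integral>x. g1' x * h1' x \<partial>M) + (\<integral>x. u x * v x \<partial>M)"
    using g1(2)[OF v(1) vG] h1(2)[OF u(1) uG] by simp
  also have "\<dots> \<le> r * (l2norm M g1' * l2norm M h1') + r * (l2norm M u * l2norm M v)"
  proof (rule add_mono)
    show "(\<integral>x. g1' x * h1' x \<partial>M) \<le> r * (l2norm M g1' * l2norm M h1')"
      unfolding g1'_def h1'_def
      by (intro mc_bound_sum[OF A(1) B(1) A(3) B(3) mc1 r] a b CG DG)
    show "(\<integral>x. u x * v x \<partial>M) \<le> r * (l2norm M u * l2norm M v)"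
      by (rule mc_boundD[OF mc2 u v])
  qed
  also have "\<dots> = r * (l2norm M g1' * l2norm M h1' + l2norm M u * l2norm M v)"
    by (simp add: algebra_simps)
  also have "\<dots> \<le> r * (l2norm M g * l2norm M h)"
    using gn hn r by (intro mult_left_mono Cauchy_Schwarz_real2) auto
  finally show ?thesis .
qed

text \<open>Passage to the limit from rectangle sums. The left side uses the centered approximants
  and the right side the norms of the uncentered ones; as \<open>a\<close> and \<open>b\<close> are
  centered, both kinds have the same limits.\<close>

lemma mc_bound_join:
  assumes A: "subalgebra G1 A1" "subalgebra G2 A2" "subalgebra A1 F" "subalgebra A2 F"
    and B: "subalgebra G1 B1" "subalgebra G2 B2" "subalgebra B1 F" "subalgebra B2 F"
    and mc: "mc_bound M F A1 B1 r" "mc_bound M F A2 B2 r" "0 \<le> r"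
    and genA: "subalgebra M A" "sets A \<subseteq> sigma_sets (space M) {E \<inter> C | E C. E \<in> sets A1 \<and> C \<in> sets A2}"
    and genB: "subalgebra M B" "sets B \<subseteq> sigma_sets (space M) {E \<inter> C | E C. E \<in> sets B1 \<and> C \<in> sets B2}"
  shows "mc_bound M F A B r"
  unfolding mc_bound_def
proof safe
  fix a b
  assume a: "sq_int M a" "a \<in> borel_measurable A" "AE x in M. real_cond_exp M F a x = 0"
    and b: "sq_int M b" "b \<in> borel_measurable B" "AE x in M. real_cond_exp M F b x = 0"
  have sub: "subalgebra M A1" "subalgebra M A2" "subalgebra M B1" "subalgebra M B2"
    using A B subalgebras by (auto simp: subalgebra_def)
  interpret RA: l2_subspace M "rect_sums M A1 A2" by (rule l2_subspace_rect_sums[OF sub(1,2)])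
  interpret RB: l2_subspace M "rect_sums M B1 B2" by (rule l2_subspace_rect_sums[OF sub(3,4)])
  obtain g where g: "\<And>n. g n \<in> rect_sums M A1 A2" "(\<lambda>n. l2norm M (\<lambda>x. g n x - a x)) \<longlonglongrightarrow> 0"
    using RA.closureE[OF sq_int_closure_rect_sums[OF sub(1,2) genA a(1,2)]] by blast
  obtain h where h: "\<And>n. h n \<in> rect_sums M B1 B2" "(\<lambda>n. l2norm M (\<lambda>x. h n x - b x)) \<longlonglongrightarrow> 0"
    using RB.closureE[OF sq_int_closure_rect_sums[OF sub(3,4) genB b(1,2)]] by blast
  have gs: "sq_int M (g n)" and hs: "sq_int M (h n)" for n
    using RA.S_sq_int[OF g(1)] RB.S_sq_int[OF h(1)] by auto
  \<comment> \<open>Centering is a contraction in mean square and fixes \<open>c\<close> almost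
    everywhere, so it preserves convergence to \<open>c\<close>.\<close>
  have centered: "sq_int M (\<lambda>x. f n x - real_cond_exp M F (f n) x)"
      "(\<lambda>n. l2norm M (\<lambda>x. f n x - real_cond_exp M F (f n) x - c x)) \<longlonglongrightarrow> 0"
    if f: "\<And>n. sq_int M (f n)" "(\<lambda>n. l2norm M (\<lambda>x. f n x - c x)) \<longlonglongrightarrow> 0"
      and c: "sq_int M c" "AE x in M. real_cond_exp M F c x = 0" for f :: "nat \<Rightarrow> 'a \<Rightarrow> real" and c and n :: nat
  proof -
    show sq: "sq_int M (\<lambda>x. f n x - real_cond_exp M F (f n) x)" for n
      by (intro sq_int_diff real_cond_exp_sq_int f subalgebras)
    have "l2norm M (\<lambda>x. f n x - real_cond_exp M F (f n) x - c x) \<le> l2norm M (\<lambda>x. f n x - c x)" for n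
    proof -
      have d: "sq_int M (\<lambda>x. f n x - c x)" by (intro sq_int_diff f c)
      have "AE x in M. f n x - real_cond_exp M F (f n) x - c x
          = f n x - c x - real_cond_exp M F (\<lambda>x. f n x - c x) x"
        using F.real_cond_exp_diff[OF sq_int_imp_integrable[OF f(1)] sq_int_imp_integrable[OF c(1)], of n] c(2)
        by eventually_elim simp
      then have "l2norm M (\<lambda>x. f n x - real_cond_exp M F (f n) x - c x)
          = l2norm M (\<lambda>x. f n x - c x - real_cond_exp M F (\<lambda>x. f n x - c x) x)"
        using sq[of n] c(1) d by (intro l2norm_cong_AE) auto
      also have "\<dots> \<le> l2norm M (\<lambda>x. f n x - c x)" by (rule l2norm_centered_le[OF subalgebras(1) d])
      finally show ?thesis .
    qed
    then show "(\<lambda>n. l2norm M (\<lambda>x. f n x - real_cond_exp M F (f n) x - c x)) \<longlonglongrightarrow> 0"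
      by (intro Lim_null_comparison[OF _ f(2)]) auto
  qed
  have "(\<lambda>n. \<integral>x. (g n x - real_cond_exp M F (g n) x) * (h n x - real_cond_exp M F (h n) x) \<partial>M)
      \<longlonglongrightarrow> (\<integral>x. a x * b x \<partial>M)"
    using centered[OF gs g(2) a(1,3)] centered[OF hs h(2) b(1,3)]
    by (intro integral_mult_tendsto a b)
  moreover have "(\<lambda>n. r * (l2norm M (g n) * l2norm M (h n))) \<longlonglongrightarrow> r * (l2norm M a * l2norm M b)"
    by (intro tendsto_intros l2norm_tendsto gs hs a b g h)
  moreover have "(\<integral>x. (g n x - real_cond_exp M F (g n) x) * (h n x - real_cond_exp M F (h n) x) \<partial>M)
      \<le> r * (l2norm M (g n) * l2norm M (h n))" for n
    by (rule mc_bound_rect_sums[OF A B mc g(1) h(1)])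
  ultimately show "(\<integral>x. a x * b x \<partial>M) \<le> r * (l2norm M a * l2norm M b)"
    by (intro LIMSEQ_le) auto
qed

end

section \<open>Sigma-algebras generated by random variables\<close>

text \<open>Including \<open>U\<close> in the generating map puts \<open>F\<close> inside every
  block. The restricted family in the product space makes this literally the algebra that
  \<open>cond_max_corr_mc_bound\<close> produces for random vectors.\<close>

definition join_algebra ::
    "'a measure \<Rightarrow> 'b measure \<Rightarrow> ('i \<Rightarrow> 'a \<Rightarrow> 'b) \<Rightarrow> ('a \<Rightarrow> real) \<Rightarrow> 'i set \<Rightarrow> 'a measure"
  where "join_algebra M N Z U J =
    vimage_algebra (space M) (\<lambda>\<omega>. (\<lambda>i\<in>J. Z i \<omega>, U \<omega>)) (PiM J (\<lambda>_. N) \<Otimes>\<^sub>M borel)"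

lemma space_join_algebra [simp]: "space (join_algebra M N Z U J) = space M"
  by (simp add: join_algebra_def)

lemma subalgebra_join_algebra:
  assumes "space G = space M" "\<And>i. i \<in> J \<Longrightarrow> Z i \<in> measurable G N" "U \<in> borel_measurable G"
  shows "subalgebra G (join_algebra M N Z U J)"
proof -
  have "(\<lambda>\<omega>. (\<lambda>i\<in>J. Z i \<omega>, U \<omega>)) \<in> measurable G (PiM J (\<lambda>_. N) \<Otimes>\<^sub>M borel)"
    using assms by (intro measurable_Pair measurable_restrict) auto
  from subalgebra_vimage_algebra[OF this] show ?thesis
    by (simp add: join_algebra_def assms(1))
qed

lemma measurable_join_algebra:
  assumes "\<And>i. i \<in> J \<Longrightarrow> Z i \<in> measurable M N"
  shows "i \<in> J \<Longrightarrow> Z i \<in> measurable (join_algebra M N Z U J) N"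
    and "U \<in> borel_measurable (join_algebra M N Z U J)"
proof -
  have *: "(\<lambda>\<omega>. (\<lambda>i\<in>J. Z i \<omega>, U \<omega>)) \<in>
      measurable (join_algebra M N Z U J) (PiM J (\<lambda>_. N) \<Otimes>\<^sub>M borel)"
    unfolding join_algebra_def
    by (intro measurable_vimage_algebra1)
       (auto simp: space_pair_measure space_PiM intro: measurable_space[OF assms])
  show "U \<in> borel_measurable (join_algebra M N Z U J)"
    using measurable_compose[OF * measurable_snd] by simp
  show "Z i \<in> measurable (join_algebra M N Z U J) N" if "i \<in> J"
    using measurable_compose[OF measurable_compose[OF * measurable_fst] measurable_component_singleton[OF that]] that
    by simp
qed

definition join_cylinder ::
    "'a measure \<Rightarrow> ('i \<Rightarrow> 'a \<Rightarrow> 'b) \<Rightarrow> ('a \<Rightarrow> real) \<Rightarrow> 'i set \<Rightarrow> ('i \<Rightarrow> 'b set) \<Rightarrow> real set \<Rightarrow> 'a set"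
  where "join_cylinder M Z U J A H = {\<omega> \<in> space M. (\<forall>j\<in>J. Z j \<omega> \<in> A j) \<and> U \<omega> \<in> H}"

text \<open>The pi-system on which conditional independence can be read off from the product
  formula.\<close>

definition join_cylinders ::
    "'a measure \<Rightarrow> 'b measure \<Rightarrow> ('i \<Rightarrow> 'a \<Rightarrow> 'b) \<Rightarrow> ('a \<Rightarrow> real) \<Rightarrow> 'i set \<Rightarrow> 'a set set"
  where "join_cylinders M N Z U J = {join_cylinder M Z U J A H | A H.
    (\<forall>j\<in>J. A j \<in> sets N) \<and> H \<in> sets borel}"

lemma join_cylindersI:
  assumes "\<And>j. j \<in> J \<Longrightarrow> A j \<in> sets N" "H \<in> sets borel"
  shows "join_cylinder M Z U J A H \<in> join_cylinders M N Z U J"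
  unfolding join_cylinders_def using assms by blast

lemma Int_stable_join_cylinders: "Int_stable (join_cylinders M N Z U J)"
proof (rule Int_stableI)
  fix X Y assume "X \<in> join_cylinders M N Z U J" "Y \<in> join_cylinders M N Z U J"
  then obtain A H A' H' where XY: "X = join_cylinder M Z U J A H" "Y = join_cylinder M Z U J A' H'"
    and *: "\<forall>j\<in>J. A j \<in> sets N" "H \<in> sets borel" "\<forall>j\<in>J. A' j \<in> sets N" "H' \<in> sets borel"
    unfolding join_cylinders_def by blast
  have "X \<inter> Y = join_cylinder M Z U J (\<lambda>j. A j \<inter> A' j) (H \<inter> H')"
    unfolding XY join_cylinder_def by auto
  with * show "X \<inter> Y \<in> join_cylinders M N Z U J"
    by (simp add: join_cylindersI)
qed

lemma join_cylinders_sets: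
  assumes "finite J" "\<And>i. i \<in> J \<Longrightarrow> Z i \<in> measurable M N" "U \<in> borel_measurable M"
  shows "join_cylinders M N Z U J \<subseteq> sets M"
proof
  fix X assume "X \<in> join_cylinders M N Z U J"
  then obtain A H where X: "X = join_cylinder M Z U J A H"
    and A: "\<forall>j\<in>J. A j \<in> sets N" "H \<in> sets borel"
    unfolding join_cylinders_def by blast
  have "{\<omega> \<in> space M. Z j \<omega> \<in> A j} \<in> sets M" if "j \<in> J" for j
    using assms(2)[OF that] A that by measurable
  moreover have "{\<omega> \<in> space M. U \<omega> \<in> H} \<in> sets M" using assms(3) A by measurable
  ultimately show "X \<in> sets M"
    unfolding X join_cylinder_def using assms(1)
    by (intro sets.sets_Collect_conj sets.sets_Collect_finite_All) auto
qed

lemma space_join_cylinders: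
  assumes "\<And>i. i \<in> J \<Longrightarrow> Z i \<in> measurable M N"
  shows "space M \<in> join_cylinders M N Z U J"
proof -
  have "space M = join_cylinder M Z U J (\<lambda>_. space N) UNIV"
    using assms by (auto simp: join_cylinder_def dest: measurable_space)
  then show ?thesis by (simp add: join_cylindersI)
qed

lemma sets_join_algebra_subset:
  assumes "\<And>i. i \<in> J \<Longrightarrow> Z i \<in> measurable M N"
  shows "sets (join_algebra M N Z U J) \<subseteq> sigma_sets (space M) (join_cylinders M N Z U J)"
proof -
  let ?E = "join_cylinders M N Z U J"
  let ?G = "sigma (space M) ?E"
  have E: "?E \<subseteq> Pow (space M)"
    by (auto simp: join_cylinders_def join_cylinder_def)
  have sG: "sets ?G = sigma_sets (space M) ?E" using E by simp
  have sp: "space ?G = space M" by (simp add: space_measure_of_conv)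
  have Z: "Z i \<in> measurable ?G N" if i: "i \<in> J" for i
  proof (rule measurableI)
    show "Z i x \<in> space N" if "x \<in> space ?G" for x
      using that measurable_space[OF assms[OF i]] by (simp add: sp)
    fix B assume B: "B \<in> sets N"
    \<comment> \<open>The unconstrained coordinates receive \<open>space N\<close>, since
      \<open>UNIV\<close> need not belong to \<open>sets N\<close>.\<close>
    have "Z i -` B \<inter> space ?G = join_cylinder M Z U J (\<lambda>j. if j = i then B else space N) UNIV"
      using i by (auto simp: join_cylinder_def sp intro: measurable_space[OF assms])
    also have "\<dots> \<in> ?E"
      using B by (intro join_cylindersI) auto
    finally show "Z i -` B \<inter> space ?G \<in> sets ?G" unfolding sG by (rule sigma_sets.Basic)
  qed
  have U: "U \<in> borel_measurable ?G"
  proof (rule measurableI)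
    fix B :: "real set" assume B: "B \<in> sets borel"
    have "U -` B \<inter> space ?G = join_cylinder M Z U J (\<lambda>_. space N) B"
      by (auto simp: join_cylinder_def sp intro: measurable_space[OF assms])
    also have "\<dots> \<in> ?E"
      using B by (intro join_cylindersI) auto
    finally show "U -` B \<inter> space ?G \<in> sets ?G" unfolding sG by (rule sigma_sets.Basic)
  qed simp
  have "subalgebra ?G (join_algebra M N Z U J)"
    by (rule subalgebra_join_algebra[OF sp Z U])
  then show ?thesis unfolding subalgebra_def sG by blast
qed

text \<open>Supplies the generation hypotheses of \<open>mc_bound_join\<close>. Intersecting with
  the whole space shows that both smaller algebras lie in the generated one, so every
  \<open>Z j\<close> and \<open>U\<close> is measurable for it.\<close>

lemma sets_join_algebra_insert_subset:
  assumes Z: "\<And>j. j \<in> insert i J \<Longrightarrow> Z j \<in> measurable M N"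
  shows "sets (join_algebra M N Z U (insert i J)) \<subseteq> sigma_sets (space M)
    {E \<inter> C | E C. E \<in> sets (join_algebra M N Z U J) \<and> C \<in> sets (join_algebra M N Z U {i})}"
proof -
  let ?G1 = "join_algebra M N Z U J" and ?G2 = "join_algebra M N Z U {i}"
  let ?E = "{E \<inter> C | E C. E \<in> sets ?G1 \<and> C \<in> sets ?G2}"
  let ?G = "sigma (space M) ?E"
  have E: "?E \<subseteq> Pow (space M)"
    using sets.sets_into_space[of _ ?G1] by (auto; blast)
  have sG: "sets ?G = sigma_sets (space M) ?E" using E by simp
  have 1: "subalgebra ?G ?G1"
    unfolding subalgebra_def sG
  proof (intro conjI subsetI)
    fix X assume X: "X \<in> sets ?G1"
    then have "X \<inter> space ?G2 \<in> ?E" by blast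
    moreover have "X \<inter> space ?G2 = X" using sets.sets_into_space[OF X] by auto
    ultimately show "X \<in> sigma_sets (space M) ?E" by (metis (no_types, lifting) sigma_sets.Basic)
  qed (simp add: space_measure_of_conv)
  have 2: "subalgebra ?G ?G2"
    unfolding subalgebra_def sG
  proof (intro conjI subsetI)
    fix X assume X: "X \<in> sets ?G2"
    then have "space ?G1 \<inter> X \<in> ?E" by blast
    moreover have "space ?G1 \<inter> X = X" using sets.sets_into_space[OF X] by auto
    ultimately show "X \<in> sigma_sets (space M) ?E" by (metis (no_types, lifting) sigma_sets.Basic)
  qed (simp add: space_measure_of_conv)
  have "Z j \<in> measurable ?G N" if "j \<in> insert i J" for j
  proof (cases "j = i")
    case True
    then show ?thesis
      using measurable_from_subalg[OF 2 measurable_join_algebra(1)[of "{i}" Z M N i U]] Z by auto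
  next
    case False
    then show ?thesis
      using measurable_from_subalg[OF 1 measurable_join_algebra(1)[of J Z M N j U]] Z that by auto
  qed
  moreover have "U \<in> borel_measurable ?G"
    using measurable_from_subalg[OF 2 measurable_join_algebra(2)[of "{i}" Z M N U]] Z by auto
  ultimately have "subalgebra ?G (join_algebra M N Z U (insert i J))"
    by (intro subalgebra_join_algebra) (auto simp: space_measure_of_conv)
  then show ?thesis unfolding subalgebra_def sG by blast
qed

section \<open>Conditional independence of blocks, and the induction over the indices\<close>

context prob_space
begin

text \<open>Pi-lambda argument for the signed set function given by \<open>w\<close>. Complements
  work because the integral over \<open>space M\<close> is 0.\<close>

lemma set_integral_eq_0_sigma_sets:
  fixes w :: "'a \<Rightarrow> real"
  assumes E: "Int_stable E" "E \<subseteq> sets M" "space M \<in> E"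
    and w: "integrable M w" "\<And>X. X \<in> E \<Longrightarrow> (\<integral>x\<in>X. w x \<partial>M) = 0"
    and D: "D \<in> sigma_sets (space M) E"
  shows "(\<integral>x\<in>D. w x \<partial>M) = 0"
proof -
  have wX: "set_integrable M X w" if "X \<in> sets M" for X
    unfolding set_integrable_def using integrable_mult_indicator[OF that w(1)] .
  have w0: "(\<integral>x\<in>space M. w x \<partial>M) = 0" by (rule w(2)[OF E(3)])
  have "E \<subseteq> Pow (space M)" using E(2) sets.sets_into_space by blast
  from E(1) this D have "D \<in> sets M \<and> (\<integral>x\<in>D. w x \<partial>M) = 0"
  proof (induction rule: sigma_sets_induct_disjoint)
    case (compl X)
    have X: "X \<subseteq> space M" using compl sets.sets_into_space by blast
    have "(\<integral>x\<in>X \<union> (space M - X). w x \<partial>M) = (\<integral>x\<in>X. w x \<partial>M) + (\<integral>x\<in>space M - X. w x \<partial>M)"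
      using compl by (intro set_integral_Un wX) auto
    moreover have "X \<union> (space M - X) = space M" using X by auto
    ultimately show ?case using compl w0 by auto
  next
    case (union X)
    have XM: "X i \<in> sets M" for i using union by auto
    then have "(\<integral>x\<in>(\<Union>i. X i). w x \<partial>M) = (\<Sum>i. \<integral>x\<in>X i. w x \<partial>M)"
      using union(1) by (intro lebesgue_integral_countable_add wX) (auto simp: disjoint_family_on_def)
    then show ?case using union XM by auto
  qed (use E w in \<open>auto simp: set_lebesgue_integral_def\<close>)
  then show ?thesis by blast
qed

text \<open>The product formula yields \<open>gen\<close> on cylinders. It is extended one argument
  at a time: first \<open>C\<close> runs through the algebra of \<open>K\<close> for a fixed
  cylinder \<open>D\<close>, then \<open>D\<close> through the algebra of \<open>J\<close>. Duality
  finally turns the statement on events into one on integrable functions.\<close>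

lemma cond_indep_vars_algebras:
  assumes U: "U \<in> borel_measurable M"
    and ci: "cond_indep_vars M (sigma_of M U) (\<lambda>_. N) Z I"
    and JK: "finite J" "finite K" "J \<subseteq> I" "K \<subseteq> I" "J \<inter> K = {}"
  shows "cond_indep_algebras M (sigma_of M U) (join_algebra M N Z U J) (join_algebra M N Z U K)"
proof -
  let ?F = "sigma_of M U" and ?GJ = "join_algebra M N Z U J" and ?GK = "join_algebra M N Z U K"
  have Z: "Z i \<in> measurable M N" if "i \<in> I" for i using ci that by (simp add: cond_indep_vars_def)
  have ZJ: "Z i \<in> measurable M N" if "i \<in> J" for i using Z JK that by auto
  have ZK: "Z i \<in> measurable M N" if "i \<in> K" for i using Z JK that by auto
  have subJ: "subalgebra M ?GJ" by (rule subalgebra_join_algebra[OF refl ZJ U])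
  have subK: "subalgebra M ?GK" by (rule subalgebra_join_algebra[OF refl ZK U])
  have subF: "subalgebra M ?F" unfolding sigma_of_def by (rule subalgebra_vimage_algebra[OF U])
  have subJF: "subalgebra ?GJ ?F"
    using subalgebra_vimage_algebra[OF measurable_join_algebra(2)[OF ZJ]] by (simp add: sigma_of_def)
  have subKF: "subalgebra ?GK ?F"
    using subalgebra_vimage_algebra[OF measurable_join_algebra(2)[OF ZK]] by (simp add: sigma_of_def)
  interpret F: sigma_finite_subalgebra M ?F by (rule sigma_finite_subalgebra_if_subalgebra[OF subF])
  interpret GJ: sigma_finite_subalgebra M ?GJ by (rule sigma_finite_subalgebra_if_subalgebra[OF subJ])
  interpret GK: sigma_finite_subalgebra M ?GK by (rule sigma_finite_subalgebra_if_subalgebra[OF subK])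
  have int1: "integrable M (indicator C :: 'a \<Rightarrow> real)" if "C \<in> sets M" for C
    by (intro sq_int_imp_integrable sq_int_indicator that)
  have cylJ: "join_cylinders M N Z U J \<subseteq> sets M" by (rule join_cylinders_sets[OF JK(1) ZJ U])
  have cylK: "join_cylinders M N Z U K \<subseteq> sets M" by (rule join_cylinders_sets[OF JK(2) ZK U])

  have gen: "(\<integral>x. indicator D x * indicator C x \<partial>M)
      = (\<integral>x. indicator D x * real_cond_exp M ?F (indicator C) x \<partial>M)"
    if D: "D \<in> join_cylinders M N Z U J" and C: "C \<in> join_cylinders M N Z U K" for C D
  proof -
    obtain A H where D: "D = join_cylinder M Z U J A H" and A: "\<forall>j\<in>J. A j \<in> sets N" "H \<in> sets borel"
      using D unfolding join_cylinders_def by blast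
    obtain B H' where C: "C = join_cylinder M Z U K B H'" and B: "\<forall>j\<in>K. B j \<in> sets N" "H' \<in> sets borel"
      using C unfolding join_cylinders_def by blast
    define P where "P = {\<omega> \<in> space M. \<forall>j\<in>J. Z j \<omega> \<in> A j}"
    define Q where "Q = {\<omega> \<in> space M. \<forall>j\<in>K. Z j \<omega> \<in> B j}"
    define V where "V = {\<omega> \<in> space M. U \<omega> \<in> H}"
    define V' where "V' = {\<omega> \<in> space M. U \<omega> \<in> H'}"
    have "P = join_cylinder M Z U J A UNIV" "Q = join_cylinder M Z U K B UNIV"
      by (auto simp: P_def Q_def join_cylinder_def)
    then have PQ: "P \<in> sets M" "Q \<in> sets M"
      using A B subsetD[OF cylJ join_cylindersI[where A = A and H = UNIV]]
        subsetD[OF cylK join_cylindersI[where A = B and H = UNIV]] by auto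
    have V: "V \<in> sets ?F" "V' \<in> sets ?F"
      using in_vimage_algebra[of H borel U "space M"] in_vimage_algebra[of H' borel U "space M"] A B
      by (auto simp: V_def V'_def sigma_of_def vimage_def Int_def conj_commute)
    have DC: "indicator D x = (indicator V x * indicator P x :: real)"
      "indicator C x = (indicator V' x * indicator Q x :: real)" for x
      by (auto simp: D C P_def Q_def V_def V'_def join_cylinder_def indicator_def)
    let ?p = "real_cond_exp M ?F (indicator P)" and ?q = "real_cond_exp M ?F (indicator Q)"
    have prod: "AE x in M. real_cond_exp M ?F (indicator {\<omega> \<in> space M. \<forall>i\<in>L. Z i \<omega> \<in> R i}) x =
        (\<Prod>i\<in>L. real_cond_exp M ?F (indicator {\<omega> \<in> space M. Z i \<omega> \<in> R i}) x)"
      if "L \<subseteq> I" "finite L" "\<forall>i\<in>L. R i \<in> sets N" for L R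
      using ci that by (simp add: cond_indep_vars_def)
    \<comment> \<open>As \<open>J\<close> and \<open>K\<close> are disjoint, both cylinders fit into
      one family, to which the product formula for \<open>J \<union> K\<close> applies.\<close>
    let ?R = "\<lambda>i. if i \<in> J then A i else B i"
    have R: "\<forall>i\<in>J \<union> K. ?R i \<in> sets N" using A B by auto
    have "{\<omega> \<in> space M. \<forall>i\<in>J \<union> K. Z i \<omega> \<in> ?R i} = P \<inter> Q"
      using JK(5) by (auto simp: P_def Q_def)
    moreover have "(\<Prod>i\<in>J \<union> K. real_cond_exp M ?F (indicator {\<omega> \<in> space M. Z i \<omega> \<in> ?R i}) x)
        = (\<Prod>i\<in>J. real_cond_exp M ?F (indicator {\<omega> \<in> space M. Z i \<omega> \<in> A i}) x) *
          (\<Prod>i\<in>K. real_cond_exp M ?F (indicator {\<omega> \<in> space M. Z i \<omega> \<in> B i}) x)" for x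
      unfolding prod.union_disjoint[OF JK(1,2,5)] using JK(5)
      by (intro arg_cong2[where f = "(*)"] prod.cong) auto
    ultimately have "AE x in M. real_cond_exp M ?F (indicator (P \<inter> Q)) x
        = (\<Prod>i\<in>J. real_cond_exp M ?F (indicator {\<omega> \<in> space M. Z i \<omega> \<in> A i}) x) *
          (\<Prod>i\<in>K. real_cond_exp M ?F (indicator {\<omega> \<in> space M. Z i \<omega> \<in> B i}) x)"
      using prod[OF _ _ R] JK by simp
    with prod[OF JK(3,1) A(1)] prod[OF JK(4,2) B(1)] have pq: "AE x in M. real_cond_exp M ?F (indicator (P \<inter> Q)) x = ?p x * ?q x"
      unfolding P_def[symmetric] Q_def[symmetric] by eventually_elim simp
    have C_eq: "AE x in M. real_cond_exp M ?F (indicator C) x = indicator V' x * ?q x"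
      using real_cond_exp_mult_indicator[OF subF V(2), of "indicator Q"] PQ by (simp add: DC(2)[symmetric])
    have i1: "integrable M (\<lambda>x. (indicator (V \<inter> V') x * ?q x) * indicator P x)"
    proof -
      have "V \<inter> V' \<in> sets M" using V subF by (auto simp: subalgebra_def)
      from integrable_mult_indicator[OF this integrable_mult_real_cond_exp_indicator[OF subF PQ(2) int1[OF PQ(1)]]]
      show ?thesis by (simp add: mult_ac)
    qed
    have i2: "integrable M (\<lambda>x. indicator (V \<inter> V') x * indicator (P \<inter> Q) x :: real)"
      using V PQ subF by (auto simp: subalgebra_def indicator_inter_arith[symmetric] intro!: int1)
    \<comment> \<open>The indicator of \<open>P \<inter> Q\<close> is conditioned on
      \<open>F\<close> and factored into \<open>?p * ?q\<close>. Then \<open>?p\<close> is turned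
      back into the indicator of \<open>P\<close>, which is allowed because its cofactor is
      \<open>F\<close>-measurable.\<close>
    have "(\<integral>x. indicator D x * indicator C x \<partial>M) = (\<integral>x. (indicator (V \<inter> V') x * indicator (P \<inter> Q) x :: real) \<partial>M)"
      by (simp add: DC indicator_inter_arith mult_ac)
    also have "\<dots> = (\<integral>x. indicator (V \<inter> V') x * real_cond_exp M ?F (indicator (P \<inter> Q)) x \<partial>M)"
      using F.real_cond_exp_intg(2)[OF i2] V PQ by auto
    also have "\<dots> = (\<integral>x. (indicator (V \<inter> V') x * ?q x) * ?p x \<partial>M)"
    proof (rule integral_cong_AE)
      show "AE x in M. indicator (V \<inter> V') x * real_cond_exp M ?F (indicator (P \<inter> Q)) x
          = indicator (V \<inter> V') x * ?q x * ?p x"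
        using pq by eventually_elim simp
    qed (use V subF in \<open>auto simp: subalgebra_def\<close>)
    also have "\<dots> = (\<integral>x. (indicator (V \<inter> V') x * ?q x) * indicator P x \<partial>M)"
      using F.real_cond_exp_intg(2)[OF i1] V PQ by auto
    also have "\<dots> = (\<integral>x. indicator D x * real_cond_exp M ?F (indicator C) x \<partial>M)"
    proof (rule integral_cong_AE)
      show "AE x in M. indicator (V \<inter> V') x * ?q x * indicator P x
          = indicator D x * real_cond_exp M ?F (indicator C) x"
        using C_eq by eventually_elim (simp add: DC indicator_inter_arith mult_ac)
      show "(\<lambda>x. indicator (V \<inter> V') x * ?q x * indicator P x) \<in> borel_measurable M"
        using i1 by measurable
      show "(\<lambda>x. indicator D x * real_cond_exp M ?F (indicator C) x) \<in> borel_measurable M"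
        using cylJ that(1) by (intro borel_measurable_times borel_measurable_indicator) auto
    qed
    finally show ?thesis .
  qed

  have set_int: "(\<integral>x\<in>X. indicator Y x - real_cond_exp M ?F (indicator Y) x \<partial>M)
      = (\<integral>x. indicator X x * indicator Y x \<partial>M) - (\<integral>x. indicator X x * real_cond_exp M ?F (indicator Y) x \<partial>M)"
    if XY: "X \<in> sets M" "Y \<in> sets M" for X Y
    unfolding set_lebesgue_integral_def
    using integrable_mult_indicator[OF XY(1) int1[OF XY(2)]]
      integrable_mult_indicator[OF XY(1) F.real_cond_exp_int(1)[OF int1[OF XY(2)]]]
    by (simp add: right_diff_distrib)
  have adj: "(\<integral>x. indicator X x * real_cond_exp M ?F (indicator Y) x \<partial>M)
      = (\<integral>x. indicator Y x * real_cond_exp M ?F (indicator X) x \<partial>M)"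
    if XY: "X \<in> sets M" "Y \<in> sets M" for X Y
    using real_cond_exp_self_adjoint[OF subF XY(2) int1[OF XY(1)]] by (simp add: mult.commute)
  \<comment> \<open>The defect from factorization is symmetric in the two events. This is what
    allows either argument to be the domain of integration in the pi-lambda step.\<close>
  have swap: "(\<integral>x\<in>X. indicator Y x - real_cond_exp M ?F (indicator Y) x \<partial>M)
      = (\<integral>x\<in>Y. indicator X x - real_cond_exp M ?F (indicator X) x \<partial>M)"
    if XY: "X \<in> sets M" "Y \<in> sets M" for X Y
    unfolding set_int[OF XY] set_int[OF XY(2,1)] adj[OF XY] by (simp add: mult.commute)
  have int_w: "integrable M (\<lambda>x. indicator Y x - real_cond_exp M ?F (indicator Y) x)" if "Y \<in> sets M" for Y
    using int1[OF that] F.real_cond_exp_int(1)[OF int1[OF that]] by simp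

  have step: "(\<integral>x\<in>C. indicator D x - real_cond_exp M ?F (indicator D) x \<partial>M) = 0"
    if D: "D \<in> join_cylinders M N Z U J" and C: "C \<in> sets ?GK" for C D
  proof (rule set_integral_eq_0_sigma_sets[OF Int_stable_join_cylinders cylK space_join_cylinders[OF ZK] int_w])
    show DM: "D \<in> sets M" using D cylJ by blast
    show "C \<in> sigma_sets (space M) (join_cylinders M N Z U K)"
      by (rule subsetD[OF sets_join_algebra_subset[OF ZK] C])
    fix X assume X: "X \<in> join_cylinders M N Z U K"
    then have XM: "X \<in> sets M" using cylK by blast
    show "(\<integral>x\<in>X. indicator D x - real_cond_exp M ?F (indicator D) x \<partial>M) = 0"
      unfolding swap[OF XM DM] set_int[OF DM XM] gen[OF D X] by simp
  qed
  have GJ_C: "AE x in M. real_cond_exp M ?GJ (indicator C) x = real_cond_exp M ?F (indicator C) x"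
    if C: "C \<in> sets ?GK" for C
  proof (rule GJ.real_cond_exp_charact)
    have CM: "C \<in> sets M" using C subK by (auto simp: subalgebra_def)
    show "integrable M (indicator C :: 'a \<Rightarrow> real)" "integrable M (real_cond_exp M ?F (indicator C))"
      using int1[OF CM] F.real_cond_exp_int(1)[OF int1[OF CM]] by auto
    show "real_cond_exp M ?F (indicator C) \<in> borel_measurable ?GJ"
      by (rule measurable_from_subalg[OF subJF borel_measurable_cond_exp])
    fix D assume D: "D \<in> sets ?GJ"
    then have DM: "D \<in> sets M" using subJ by (auto simp: subalgebra_def)
    have "(\<integral>x\<in>D. indicator C x - real_cond_exp M ?F (indicator C) x \<partial>M) = 0"
    proof (rule set_integral_eq_0_sigma_sets[OF Int_stable_join_cylinders cylJ space_join_cylinders[OF ZJ] int_w[OF CM]])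
      show "D \<in> sigma_sets (space M) (join_cylinders M N Z U J)"
        by (rule subsetD[OF sets_join_algebra_subset[OF ZJ] D])
      fix X assume X: "X \<in> join_cylinders M N Z U J"
      then have XM: "X \<in> sets M" using cylJ by blast
      show "(\<integral>x\<in>X. indicator C x - real_cond_exp M ?F (indicator C) x \<partial>M) = 0"
        unfolding swap[OF XM CM] by (rule step[OF X C])
    qed
    then show "(\<integral>x\<in>D. indicator C x \<partial>M) = (\<integral>x\<in>D. real_cond_exp M ?F (indicator C) x \<partial>M)"
      unfolding set_int[OF DM CM] by (simp add: set_lebesgue_integral_def)
  qed
  have "AE x in M. real_cond_exp M ?GK a x = real_cond_exp M ?F a x"
    if a: "a \<in> borel_measurable ?GJ" "integrable M a" for a
  proof (rule GK.real_cond_exp_charact)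
    show "integrable M a" "integrable M (real_cond_exp M ?F a)"
      using a F.real_cond_exp_int(1) by auto
    show "real_cond_exp M ?F a \<in> borel_measurable ?GK"
      by (rule measurable_from_subalg[OF subKF borel_measurable_cond_exp])
    fix C assume C: "C \<in> sets ?GK"
    then have CM: "C \<in> sets M" using subK by (auto simp: subalgebra_def)
    have i: "integrable M (\<lambda>x. a x * indicator C x)"
      using integrable_mult_indicator[OF CM a(2)] by (simp add: mult.commute)
    have aM: "a \<in> borel_measurable M" using a(2) by simp
    \<comment> \<open>Conditioning the indicator on \<open>?GJ\<close>, for which \<open>a\<close>
      is measurable, reduces a general \<open>a\<close> to the known case of events.\<close>
    have "(\<integral>x. a x * indicator C x \<partial>M) = (\<integral>x. a x * real_cond_exp M ?GJ (indicator C) x \<partial>M)"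
      using GJ.real_cond_exp_intg(2)[OF i a(1)] CM by simp
    also have "\<dots> = (\<integral>x. a x * real_cond_exp M ?F (indicator C) x \<partial>M)"
      using GJ_C[OF C] aM by (intro integral_cong_AE) auto
    also have "\<dots> = (\<integral>x. real_cond_exp M ?F a x * indicator C x \<partial>M)"
      by (rule real_cond_exp_self_adjoint[OF subF CM a(2), symmetric])
    finally show "(\<integral>x\<in>C. a x \<partial>M) = (\<integral>x\<in>C. real_cond_exp M ?F a x \<partial>M)"
      by (simp add: set_lebesgue_integral_def mult.commute)
  qed
  with subF subJ subK subJF subKF show ?thesis
    by unfold_locales auto
qed

text \<open>One index is added at a time. The two conditionally independent blocks are generated by
  the pairs over \<open>J\<close> and over \<open>{i}\<close>; the algebras of the \<open>X\<close>
  and of the \<open>Y\<close> sit inside them.\<close>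

lemma mc_bound_join_algebra:
  fixes X Y :: "'i \<Rightarrow> 'a \<Rightarrow> real"
  assumes X: "\<And>i. i \<in> I \<Longrightarrow> X i \<in> borel_measurable M" and Y: "\<And>i. i \<in> I \<Longrightarrow> Y i \<in> borel_measurable M"
    and U: "U \<in> borel_measurable M"
    and ci: "cond_indep_vars M (sigma_of M U) (\<lambda>_. borel \<Otimes>\<^sub>M borel) (\<lambda>i \<omega>. (X i \<omega>, Y i \<omega>)) I"
    and r: "0 \<le> r"
    and mc: "\<And>i. i \<in> I \<Longrightarrow> mc_bound M (sigma_of M U) (join_algebra M borel X U {i}) (join_algebra M borel Y U {i}) r"
    and J: "finite J" "J \<noteq> {}" "J \<subseteq> I"
  shows "mc_bound M (sigma_of M U) (join_algebra M borel X U J) (join_algebra M borel Y U J) r"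
  using J
proof (induction J rule: finite_ne_induct)
  case (singleton i)
  then show ?case using mc by simp
next
  case (insert i J)
  let ?Z = "\<lambda>i \<omega>. (X i \<omega>, Y i \<omega>)" and ?N = "borel \<Otimes>\<^sub>M borel :: (real \<times> real) measure"
  let ?F = "sigma_of M U"
  interpret cond_indep_algebras M ?F "join_algebra M ?N ?Z U J" "join_algebra M ?N ?Z U {i}"
    using insert by (intro cond_indep_vars_algebras[OF U ci]) auto
  have XY: "subalgebra (join_algebra M ?N ?Z U K) (join_algebra M borel X U K)"
      "subalgebra (join_algebra M ?N ?Z U K) (join_algebra M borel Y U K)"
      "subalgebra (join_algebra M borel X U K) ?F" "subalgebra (join_algebra M borel Y U K) ?F"
    if K: "K \<subseteq> I" for K
  proof -
    have Z: "?Z j \<in> measurable M ?N" if "j \<in> K" for j using X Y K that by (intro measurable_Pair) auto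
    note m = measurable_join_algebra[of K ?Z M ?N, OF Z]
    have "X j \<in> borel_measurable (join_algebra M ?N ?Z U K)" "Y j \<in> borel_measurable (join_algebra M ?N ?Z U K)"
      if "j \<in> K" for j
      using measurable_compose[OF m(1)[OF _ that] measurable_fst] measurable_compose[OF m(1)[OF _ that] measurable_snd]
      by auto
    then show "subalgebra (join_algebra M ?N ?Z U K) (join_algebra M borel X U K)"
      "subalgebra (join_algebra M ?N ?Z U K) (join_algebra M borel Y U K)"
      using m(2) by (auto intro!: subalgebra_join_algebra)
    have "U \<in> borel_measurable (join_algebra M borel X U K)" "U \<in> borel_measurable (join_algebra M borel Y U K)"
      using X Y K by (auto intro!: measurable_join_algebra)
    from this[THEN subalgebra_vimage_algebra]
    show "subalgebra (join_algebra M borel X U K) ?F" "subalgebra (join_algebra M borel Y U K) ?F"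
      by (simp_all add: sigma_of_def)
  qed
  have J: "J \<subseteq> I" "{i} \<subseteq> I" using insert by auto
  show ?case
  proof (rule mc_bound_join[OF XY(1)[OF J(1)] XY(1)[OF J(2)] XY(3)[OF J(1)] XY(3)[OF J(2)]
        XY(2)[OF J(1)] XY(2)[OF J(2)] XY(4)[OF J(1)] XY(4)[OF J(2)] _ _ r])
    show "mc_bound M ?F (join_algebra M borel X U J) (join_algebra M borel Y U J) r"
      by (rule insert.IH[OF J(1)])
    show "mc_bound M ?F (join_algebra M borel X U {i}) (join_algebra M borel Y U {i}) r"
      using J by (intro mc) auto
    show "subalgebra M (join_algebra M borel X U (insert i J))"
      "subalgebra M (join_algebra M borel Y U (insert i J))"
      using insert X Y U by (auto intro!: subalgebra_join_algebra)
  qed (use insert X Y in \<open>auto intro!: sets_join_algebra_insert_subset\<close>)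
qed

end

theorem theorem7:
  fixes M :: "'a measure" and n :: nat
    and X Y :: "nat \<Rightarrow> 'a \<Rightarrow> real" and U :: "'a \<Rightarrow> real"
  assumes "prob_space M"
    and "1 \<le> n"
    and "\<And>i. i \<in> {1..n} \<Longrightarrow> X i \<in> borel_measurable M"
    and "\<And>i. i \<in> {1..n} \<Longrightarrow> Y i \<in> borel_measurable M"
    and "U \<in> borel_measurable M"
    and "cond_indep_vars M (sigma_of M U) (\<lambda>_. borel \<Otimes>\<^sub>M borel) (\<lambda>i \<omega>. (X i \<omega>, Y i \<omega>)) {1..n}"
  shows "cond_max_corr M
      (PiM {1..n} (\<lambda>_. borel)) (\<lambda>\<omega>. \<lambda>i\<in>{1..n}. X i \<omega>)
      (PiM {1..n} (\<lambda>_. borel)) (\<lambda>\<omega>. \<lambda>i\<in>{1..n}. Y i \<omega>) U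
    = Max ((\<lambda>i. cond_max_corr M borel (X i) borel (Y i) U) ` {1..n})"
    (is "?\<rho> = Max (?\<rho>i ` ?I)")
proof -
  interpret prob_space M by fact
  let ?F = "sigma_of M U"
  let ?A = "\<lambda>i. vimage_algebra (space M) (\<lambda>\<omega>. (X i \<omega>, U \<omega>)) (borel \<Otimes>\<^sub>M borel)"
  let ?B = "\<lambda>i. vimage_algebra (space M) (\<lambda>\<omega>. (Y i \<omega>, U \<omega>)) (borel \<Otimes>\<^sub>M borel)"
  note X = assms(3) and Y = assms(4) and U = assms(5)
  have XI: "(\<lambda>\<omega>. \<lambda>i\<in>?I. X i \<omega>) \<in> measurable M (PiM ?I (\<lambda>_. borel))"
    and YI: "(\<lambda>\<omega>. \<lambda>i\<in>?I. Y i \<omega>) \<in> measurable M (PiM ?I (\<lambda>_. borel))"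
    using X Y by (auto intro!: measurable_restrict)
  note \<rho> = cond_max_corr_mc_bound[OF XI YI U, folded join_algebra_def]
  note \<rho>i = cond_max_corr_mc_bound[OF X Y U]
  \<comment> \<open>The first inclusion restricts from the whole vector to one coordinate. The
    second is required because \<open>Z i\<close> and the one-entry family over \<open>{i}\<close>
    are different maps.\<close>
  have sub: "subalgebra (join_algebra M borel Z U ?I)
      (vimage_algebra (space M) (\<lambda>\<omega>. (Z i \<omega>, U \<omega>)) (borel \<Otimes>\<^sub>M borel))"
    "subalgebra (vimage_algebra (space M) (\<lambda>\<omega>. (Z i \<omega>, U \<omega>)) (borel \<Otimes>\<^sub>M borel))
      (join_algebra M borel Z U {i})"
    if i: "i \<in> ?I" and Z: "\<And>i. i \<in> ?I \<Longrightarrow> Z i \<in> borel_measurable M" for i and Z :: "nat \<Rightarrow> 'a \<Rightarrow> real"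
  proof -
    let ?G = "join_algebra M borel Z U ?I"
    let ?V = "vimage_algebra (space M) (\<lambda>\<omega>. (Z i \<omega>, U \<omega>)) (borel \<Otimes>\<^sub>M borel)"
    have "Z i \<in> borel_measurable ?G" "U \<in> borel_measurable ?G"
      using Z i by (auto intro!: measurable_join_algebra)
    then have "(\<lambda>\<omega>. (Z i \<omega>, U \<omega>)) \<in> measurable ?G (borel \<Otimes>\<^sub>M borel)" by measurable
    from subalgebra_vimage_algebra[OF this] show "subalgebra ?G ?V" by simp
    have "(\<lambda>\<omega>. (Z i \<omega>, U \<omega>)) \<in> measurable ?V (borel \<Otimes>\<^sub>M borel)"
      by (rule measurable_vimage_algebra1) (auto simp: space_pair_measure)
    from measurable_compose[OF this measurable_fst] measurable_compose[OF this measurable_snd]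
    show "subalgebra ?V (join_algebra M borel Z U {i})"
      by (intro subalgebra_join_algebra) auto
  qed
  \<comment> \<open>The easy direction: a function of \<open>(X i, U)\<close> is also a function of
    the whole vector and \<open>U\<close>.\<close>
  have le: "?\<rho>i i \<le> ?\<rho>" if i: "i \<in> ?I" for i
    by (intro \<rho>i(3)[OF i i] \<rho>(1) mc_bound_subalgebra[OF \<rho>(2)] sub(1)[OF i] X Y)
  define r where "r = Max (?\<rho>i ` ?I)"
  have ri: "?\<rho>i i \<le> r" if "i \<in> ?I" for i
    unfolding r_def using that by (intro Max_ge) auto
  \<comment> \<open>The induction requires a nonnegative constant; the index 1 exists because
    \<open>1 \<le> n\<close>.\<close>
  have r0: "0 \<le> r"
    using \<rho>i(1)[of 1] ri[of 1] assms(2) by force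
  have mc: "mc_bound M ?F (join_algebra M borel X U {i}) (join_algebra M borel Y U {i}) r" if i: "i \<in> ?I" for i
    by (intro mc_bound_mono[OF mc_bound_subalgebra[OF \<rho>i(2)[OF i i]] ri[OF i]] sub(2)[OF i] X Y)
  have "mc_bound M ?F (join_algebra M borel X U ?I) (join_algebra M borel Y U ?I) r"
    by (rule mc_bound_join_algebra[where I = ?I, OF X Y U assms(6) r0 mc]) (use assms(2) in simp_all)
  then have "?\<rho> \<le> r" by (rule \<rho>(3)[OF r0])
  moreover have "r \<le> ?\<rho>"
    unfolding r_def using le assms(2) by (intro Max.boundedI) auto
  ultimately show ?thesis unfolding r_def by simp
qed

end
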